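(* Let $(X,S)$ be a Toeplitz subshift with scale $\mathsf{u}$. Then the following are equivalent: (1) $(X,S)$ is conjugate to $(X,S^{-1})$; (2) for every Toeplitz sequence $x\in X$, there is a positive integer $p\mid\mathsf{u}$ such that for every integer $q\mid\mathsf{u}$ with $p\mid q$ and $p<q$, $x$ has nice symmetries with respect to $(p,q)$; (3) the set of $x\in X$ for which there is a positive integer $p\mid\mathsf{u}$ such that for every integer $q\mid\mathsf{u}$ with $p\mid q$ and $p<q$, $x$ has nice symmetries with respect to $(p,q)$, is nonmeager in $X$; (4) there exist a Toeplitz sequence $x\in X$ and a positive integer $p\mid\mathsf{u}$ such that for every integer $q\mid\mathsf{u}$ with $p\mid q$ and $p<q$, $x$ has nice symmetries with respect to $(p,q)$.
   Context: **Toeplitz subshifts.** For a finite alphabet $\mathsf{A}$, $S$ is the shift on $\mathsf{A}^{\mathbb{Z}}$, $S(x)(i)=x(i+1)$. A sequence $x\in\mathsf{A}^{\mathbb{Z}}$ is a Toeplitz sequence if for every $i\in\mathbb{Z}$ there is $p\geq1$ with $x(i)=x(i+kp)$ for all $k\in\mathbb{Z}$. A Toeplitz subshift is the closure in $\mathsf{A}^{\mathbb{Z}}$ of the $S$-orbit of a Toeplitz sequence. Systems $(X,T)$, $(Y,T')$ are conjugate if there is a homeomorphism $\varphi\colon X\to Y$ with $\varphi\circ T=T'\circ\varphi$. For $x\in\mathsf{A}^{\mathbb{Z}}$ and $i\leq j$, $x[i,j)$ is the word $x(i)x(i+1)\cdots x(j-1)$; $[i,j)$ also denotes the set of integers $k$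 with $i\le k<j$. **Scale.** Let $\mathrm{Per}_p(x)=\{i\in\mathbb{Z}: x(i)=x(i+kp)\text{ for all }k\in\mathbb{Z}\}$. The $p$-skeleton of $x$ is the sequence equal to $x(i)$ at $i\in\mathrm{Per}_p(x)$ and to a blank symbol $\square$ elsewhere. For a Toeplitz sequence $x$, $p$ is an essential period of $x$ if the $p$-skeleton of $x$ is not periodic with any smaller period. A supernatural number is a formal product $\prod_{p\text{ prime}}p^{n_p}$, $n_p\in\mathbb{N}\cup\{\infty\}$, with the obvious divisibility. The scale of a Toeplitz subshift $X$ is the supernatural number which is the least common multiple of all essential periods of any Toeplitz sequence $x\in X$ (it does not depend on the choice of $x$). **Nice symmetries.** Let $p<q$ be positive integers with $p\mid q$. A sequence $x\in\mathsf{A}^{\mathbb{Z}}$ has nice symmetries with respect to $(p,q)$ if there is an integer $m$ with $1<m\leq q+1$ such that: (a) for any $0\leq k<q/p$, $[kp,(k+1)p)\subseteq\mathrm{Per}_q(x)$ if and only if $[m-(k+1)p,m-kp)\subseteq\mathrm{Per}_q(x)$; and (b) for any $0\leq k,k'<q/p$, if $[kp,(k+1)p)\subseteq\mathrm{Per}_q(x)$ and $[k'p,(k'+1)p)\subseteq\mathrm{Per}_q(x)$, then $x[kp,(k+1)p)=x[k'p,(k'+1)p)$ if and only if $x[m-(k+1)p,m-kp)=x[m-(k'+1)p,m-k'p)$. *)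

theory Defs
  imports
    "HOL-Analysis.Analysis"
    "HOL-Computational_Algebra.Primes"
    "HOL-Library.Extended_Nat"
begin

section \<open>Topological dynamics\<close>

definition nowhere_dense_in :: "'b topology \<Rightarrow> 'b set \<Rightarrow> bool" where
  "nowhere_dense_in X A \<longleftrightarrow> A \<subseteq> topspace X \<and> X interior_of (X closure_of A) = {}"

definition meager_in :: "'b topology \<Rightarrow> 'b set \<Rightarrow> bool" where
  "meager_in X A \<longleftrightarrow> (\<exists>\<N>. countable \<N> \<and> (\<forall>N\<in>\<N>. nowhere_dense_in X N) \<and> A = \<Union>\<N>)"

definition conjugate :: "'b topology \<Rightarrow> ('b \<Rightarrow> 'b) \<Rightarrow> 'c topology \<Rightarrow> ('c \<Rightarrow> 'c) \<Rightarrow> bool" where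
  "conjugate X T Y T' \<longleftrightarrow>
     (\<exists>\<phi>. homeomorphic_map X Y \<phi> \<and> (\<forall>x\<in>topspace X. \<phi> (T x) = T' (\<phi> x)))"


section \<open>Toeplitz subshifts\<close>

text \<open>The alphabet is a finite type \<open>'a\<close>, carrying the discrete topology.\<close>

definition full_shift :: "(int \<Rightarrow> 'a::finite) topology" where
  "full_shift = product_topology (\<lambda>_. discrete_topology UNIV) UNIV"

definition shift :: "(int \<Rightarrow> 'a) \<Rightarrow> (int \<Rightarrow> 'a)" where
  "shift x = (\<lambda>i. x (i + 1))"

lemma topspace_full_shift [simp]: "topspace full_shift = UNIV"
  by (simp add: full_shift_def)

lemma bij_shift: "bij shift"
proof (rule bij_betw_byWitness[where f' = "\<lambda>x i. x (i - 1)"])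
qed (auto simp: shift_def)

lemma inv_shift: "inv shift x = (\<lambda>i. x (i - 1))"
  by (rule inv_f_eq) (auto simp: shift_def bij_is_inj[OF bij_shift])

definition shift_orbit :: "(int \<Rightarrow> 'a) \<Rightarrow> (int \<Rightarrow> 'a) set" where
  "shift_orbit x = (\<Union>n::nat. {(shift ^^ n) x, (inv shift ^^ n) x})"

definition toeplitz_sequence :: "(int \<Rightarrow> 'a) \<Rightarrow> bool" where
  "toeplitz_sequence x \<longleftrightarrow> (\<forall>i. \<exists>p::nat. p \<ge> 1 \<and> (\<forall>k. x i = x (i + k * int p)))"

definition toeplitz_subshift :: "(int \<Rightarrow> 'a::finite) set \<Rightarrow> bool" where
  "toeplitz_subshift X \<longleftrightarrow>
     (\<exists>x. toeplitz_sequence x \<and> X = full_shift closure_of (shift_orbit x))"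


section \<open>Supernatural numbers and the scale\<close>

text \<open>
  A supernatural number is given by its exponents at the primes, with the value \<open>0\<close> at
  non-primes. Divisibility is then the pointwise order and the least common multiple of a set
  is its pointwise supremum.
\<close>

type_synonym supernatural = "nat \<Rightarrow> enat"

text \<open>Only meaningful for positive arguments, as \<open>multiplicity r 0 = 0\<close>.\<close>

definition supernatural_of_nat :: "nat \<Rightarrow> supernatural" where
  "supernatural_of_nat n = (\<lambda>r. if prime r then enat (multiplicity r n) else 0)"

definition supernatural_dvd :: "supernatural \<Rightarrow> supernatural \<Rightarrow> bool" where
  "supernatural_dvd u v \<longleftrightarrow> (\<forall>r. prime r \<longrightarrow> u r \<le> v r)"

definition supernatural_Lcm :: "supernatural set \<Rightarrow> supernatural" where
  "supernatural_Lcm U = (\<lambda>r. SUP u\<in>U. u r)"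

definition Per :: "nat \<Rightarrow> (int \<Rightarrow> 'a) \<Rightarrow> int set" where
  "Per p x = {i. \<forall>k. x i = x (i + k * int p)}"

text \<open>The blank symbol is \<open>None\<close>.\<close>

definition skeleton :: "nat \<Rightarrow> (int \<Rightarrow> 'a) \<Rightarrow> (int \<Rightarrow> 'a option)" where
  "skeleton p x = (\<lambda>i. if i \<in> Per p x then Some (x i) else None)"

definition essential_period :: "nat \<Rightarrow> (int \<Rightarrow> 'a) \<Rightarrow> bool" where
  "essential_period p x \<longleftrightarrow>
     0 < p \<and> \<not> (\<exists>r::nat. 0 < r \<and> r < p \<and> (\<forall>i. skeleton p x (i + int r) = skeleton p x i))"

definition sequence_scale :: "(int \<Rightarrow> 'a) \<Rightarrow> supernatural" where
  "sequence_scale x = supernatural_Lcm (supernatural_of_nat ` {p. essential_period p x})"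

text \<open>For a Toeplitz subshift, all Toeplitz sequences in it yield the same value.\<close>

definition scale :: "(int \<Rightarrow> 'a) set \<Rightarrow> supernatural" where
  "scale X = sequence_scale (SOME x. x \<in> X \<and> toeplitz_sequence x)"


section \<open>Nice symmetries\<close>

definition subword :: "(int \<Rightarrow> 'a) \<Rightarrow> int \<Rightarrow> int \<Rightarrow> 'a list" where
  "subword x i j = map x [i..j - 1]"

text \<open>Meant for \<open>0 < p < q\<close> with \<open>p dvd q\<close>, so that \<open>q div p\<close> is the exact quotient.\<close>

definition nice_symmetries :: "(int \<Rightarrow> 'a) \<Rightarrow> nat \<Rightarrow> nat \<Rightarrow> bool" where
  "nice_symmetries x p q \<longleftrightarrow>
    (\<exists>m::int. 1 < m \<and> m \<le> int q + 1 \<and>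
      (\<forall>k. 0 \<le> k \<and> k < int (q div p) \<longrightarrow>
         ({k * int p..<(k + 1) * int p} \<subseteq> Per q x \<longleftrightarrow>
          {m - (k + 1) * int p..<m - k * int p} \<subseteq> Per q x)) \<and>
      (\<forall>k k'. 0 \<le> k \<and> k < int (q div p) \<and> 0 \<le> k' \<and> k' < int (q div p) \<longrightarrow>
         {k * int p..<(k + 1) * int p} \<subseteq> Per q x \<and>
         {k' * int p..<(k' + 1) * int p} \<subseteq> Per q x \<longrightarrow>
         (subword x (k * int p) ((k + 1) * int p) = subword x (k' * int p) ((k' + 1) * int p)
          \<longleftrightarrow>
          subword x (m - (k + 1) * int p) (m - k * int p) =
          subword x (m - (k' + 1) * int p) (m - k' * int p))))"

definition nice_symmetries_along :: "supernatural \<Rightarrow> (int \<Rightarrow> 'a) \<Rightarrow> nat \<Rightarrow> bool" where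
  "nice_symmetries_along u x p \<longleftrightarrow>
     0 < p \<and> supernatural_dvd (supernatural_of_nat p) u \<and>
     (\<forall>q. supernatural_dvd (supernatural_of_nat q) u \<and> p dvd q \<and> p < q
            \<longrightarrow> nice_symmetries x p q)"

end

theory Submission
  imports Defs
begin

text \<open>
  Two facts about a Toeplitz sequence \<open>x\<close> with orbit closure \<open>X\<close> carry the proof. First, \<open>X\<close> is
  minimal, and for each \<open>q > 0\<close> the \<open>q\<close>-skeleton of every point of \<open>X\<close> is a translate of the
  \<open>q\<close>-skeleton of \<open>x\<close>. Secondly, if \<open>p\<close> divides the scale, then the position modulo \<open>p\<close> can be read off
  from a window of bounded size, in any point of \<open>X\<close>. The statements on skeletons and on positions
  rest on \<open>Per_detection\<close>: a position that is not \<open>p\<close>-periodic betrays itself within a bounded distance.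

  A conjugacy between the shift and its inverse is a sliding block code followed by the reflection
  \<open>i \<mapsto> -i\<close>. It is determined by the image of \<open>x\<close>, so it exists if and only if there is a sequence
  \<open>w\<close> whose reflection lies in \<open>X\<close> such that \<open>x\<close> and \<open>w\<close> determine each other by local rules.

  Given such a \<open>w\<close>, choose \<open>p\<close> dividing the scale such that a window around \<open>0\<close> that is large compared to
  the radius of the rules is \<open>p\<close>-periodic in \<open>x\<close>. Then the letters of \<open>x\<close> near the boundaries of the blocks
  \<open>[kp, (k+1)p)\<close> are the same for all \<open>k\<close>, so the local rules act on single blocks, and \<open>x\<close> and
  \<open>w\<close> have the same \<open>q\<close>-periodic blocks and the same coincidences between blocks. As the reflection of
  \<open>w\<close> has the \<open>q\<close>-skeleton of a translate of \<open>x\<close>, one can replace \<open>w\<close> by a reflection \<open>i \<mapsto> x(n - i)\<close>,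
  and this is a nice symmetry with respect to \<open>(p, q)\<close>.

  Conversely, let \<open>x\<close> have nice symmetries with respect to \<open>(p, q)\<close> for all \<open>q\<close>, witnessed by
  reflections \<open>i \<mapsto> x(n\<^sub>q - i)\<close>. A cluster point \<open>w\<close> of these reflections has a reflection in \<open>X\<close>, and two
  blocks of \<open>x\<close> are equal if and only if the corresponding blocks of \<open>w\<close> are. As block boundaries can be
  recognized locally, \<open>x\<close> and \<open>w\<close> determine each other by local rules.

  The condition on category lies between the conditions for all and for some Toeplitz sequences
  because Toeplitz sequences are comeager in \<open>X\<close> and \<open>X\<close> is a Baire space.
\<close>

section \<open>Windows and orbit closures\<close>

definition same_window :: "int \<Rightarrow> (int \<Rightarrow> 'a) \<Rightarrow> int \<Rightarrow> (int \<Rightarrow> 'a) \<Rightarrow> int \<Rightarrow> bool" where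
  "same_window n y i x j \<longleftrightarrow> (\<forall>d. \<bar>d\<bar> \<le> n \<longrightarrow> y (i + d) = x (j + d))"

lemma same_window_mono: "same_window N y i x j \<Longrightarrow> M \<le> N \<Longrightarrow> same_window M y i x j"
  by (auto simp: same_window_def)

lemma same_window_commute: "same_window n y i z j \<longleftrightarrow> same_window n z j y i"
  by (auto simp: same_window_def)

lemma same_window_trans:
  "same_window n x i y j \<Longrightarrow> same_window n y j z k \<Longrightarrow> same_window n x i z k"
  by (auto simp: same_window_def)

definition translate :: "int \<Rightarrow> (int \<Rightarrow> 'a) \<Rightarrow> (int \<Rightarrow> 'a)" where
  "translate t x = (\<lambda>i. x (i + t))"

lemma same_window_translate:
  "same_window n (translate s y) i (translate t z) j \<longleftrightarrow> same_window n y (i + s) z (j + t)"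
  by (simp add: same_window_def translate_def algebra_simps)

lemma same_window_translate_0:
  "same_window n (translate t x) 0 y 0 \<longleftrightarrow> same_window n y 0 x t"
  by (auto simp: same_window_def translate_def algebra_simps)

lemma translate_0: "translate 0 x = x"
  by (simp add: translate_def)

definition reflect :: "int \<Rightarrow> (int \<Rightarrow> 'a) \<Rightarrow> (int \<Rightarrow> 'a)" where
  "reflect n x = (\<lambda>i. x (n - i))"

lemma same_window_reflect:
  "same_window N (reflect a y) i (reflect b z) j \<longleftrightarrow> same_window N y (a - i) z (b - j)"
proof -
  have "same_window N y (a - i) z (b - j)" if "same_window N (reflect a y) i (reflect b z) j"
    for a b y z i j
    unfolding same_window_def
  proof (intro allI impI)
    fix d :: int assume "\<bar>d\<bar> \<le> N"
    then have "reflect a y (i + (- d)) = reflect b z (j + (- d))"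
      using that[unfolded same_window_def, rule_format, of "- d"] by simp
    then show "y (a - i + d) = z (b - j + d)" by (simp add: reflect_def algebra_simps)
  qed
  from this[of a y i b z j] this[of a "reflect a y" "a - i" b "reflect b z" "b - j"]
  show ?thesis by (auto simp: reflect_def)
qed

lemma reflect_reflect [simp]: "reflect a (reflect a x) = x"
  by (simp add: reflect_def)

text \<open>
  A combinatorial description of the closure of the shift orbit of \<open>x\<close>, see
  \<open>closure_of_shift_orbit\<close>: each central window of \<open>y\<close> occurs in \<open>x\<close>.
\<close>

definition orbit_closure :: "(int \<Rightarrow> 'a) \<Rightarrow> (int \<Rightarrow> 'a) set" where
  "orbit_closure x = {y. \<forall>n. \<exists>t. same_window n y 0 x t}"

lemma orbit_closureD:
  assumes "y \<in> orbit_closure x"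
  shows "\<exists>t. \<forall>i. \<bar>i\<bar> \<le> n \<longrightarrow> y i = x (i + t)"
  using assms by (simp add: orbit_closure_def same_window_def add.commute)

lemma orbit_closureI:
  assumes "\<And>n. \<exists>t. \<forall>i. \<bar>i\<bar> \<le> n \<longrightarrow> y i = x (i + t)"
  shows "y \<in> orbit_closure x"
  using assms by (simp add: orbit_closure_def same_window_def add.commute)

lemma translate_in_orbit_closure: "y \<in> orbit_closure x \<Longrightarrow> translate t y \<in> orbit_closure x"
proof (rule orbit_closureI)
  fix n assume y: "y \<in> orbit_closure x"
  obtain s where s: "\<And>i. \<bar>i\<bar> \<le> n + \<bar>t\<bar> \<Longrightarrow> y i = x (i + s)"
    using orbit_closureD[OF y, of "n + \<bar>t\<bar>"] by blast
  have "\<forall>i. \<bar>i\<bar> \<le> n \<longrightarrow> translate t y i = x (i + (t + s))"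
    unfolding translate_def using s by (auto simp: add.assoc[symmetric])
  then show "\<exists>s. \<forall>i. \<bar>i\<bar> \<le> n \<longrightarrow> translate t y i = x (i + s)" by blast
qed

lemma orbit_closure_refl: "x \<in> orbit_closure x"
  by (rule orbit_closureI) (rule exI[of _ 0], simp)

lemma orbit_closure_trans:
  assumes "z \<in> orbit_closure y" "y \<in> orbit_closure x"
  shows "z \<in> orbit_closure x"
proof (rule orbit_closureI)
  fix n
  obtain s where s: "\<And>i. \<bar>i\<bar> \<le> n \<Longrightarrow> z i = y (i + s)"
    using orbit_closureD[OF assms(1), of n] by blast
  obtain t where t: "\<And>i. \<bar>i\<bar> \<le> n + \<bar>s\<bar> \<Longrightarrow> y i = x (i + t)"
    using orbit_closureD[OF assms(2), of "n + \<bar>s\<bar>"] by blast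
  have "\<forall>i. \<bar>i\<bar> \<le> n \<longrightarrow> z i = x (i + (s + t))"
    using s t by (auto simp: add.assoc[symmetric])
  then show "\<exists>t. \<forall>i. \<bar>i\<bar> \<le> n \<longrightarrow> z i = x (i + t)" by blast
qed

lemma orbit_closure_reflect:
  assumes "y \<in> orbit_closure x"
  shows "reflect 0 y \<in> orbit_closure (reflect 0 x)"
  unfolding orbit_closure_def mem_Collect_eq
proof
  fix n
  obtain t where "same_window n y 0 x t" using assms by (auto simp: orbit_closure_def)
  then have "same_window n (reflect 0 y) 0 (reflect 0 x) (- t)"
    by (simp add: same_window_reflect)
  then show "\<exists>t. same_window n (reflect 0 y) 0 (reflect 0 x) t" by blast
qed


section \<open>Periodic positions and minimality\<close>

lemma PerD: "i \<in> Per p x \<Longrightarrow> x (i + k * int p) = x i"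
  by (simp add: Per_def)

lemma Per_eq:
  assumes "i \<in> Per p x" "int p dvd i - j"
  shows "x j = x i"
proof -
  obtain k where "i - j = int p * k" using assms(2) by blast
  then have "j = i + (-k) * int p" by (simp add: algebra_simps)
  then show ?thesis using PerD[OF assms(1), of "-k"] by simp
qed

lemma Per_cong_mem:
  assumes "i \<in> Per p x" "int p dvd i - j"
  shows "j \<in> Per p x"
proof -
  have "x (j + k * int p) = x j" for k
  proof -
    have "int p dvd (i - j) - k * int p" using assms(2) by (rule dvd_diff) simp
    then have "x (j + k * int p) = x i" by (intro Per_eq[OF assms(1)]) (simp add: algebra_simps)
    then show ?thesis using Per_eq[OF assms] by simp
  qed
  then show ?thesis by (simp add: Per_def)
qed

lemma Per_cong_iff:
  assumes "int p dvd i - j"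
  shows "i \<in> Per p x \<longleftrightarrow> j \<in> Per p x"
  using assms Per_cong_mem[of i p x j] Per_cong_mem[of j p x i] by (auto simp: dvd_diff_commute)

lemma Per_mono: "p dvd q \<Longrightarrow> Per p x \<subseteq> Per q x"
proof
  fix i assume "p dvd q" "i \<in> Per p x"
  then have "x (i + k * int q) = x i" for k
    by (intro Per_eq[of i p]) auto
  then show "i \<in> Per q x" by (simp add: Per_def)
qed

lemma Per_reflect: "i \<in> Per q (reflect n x) \<longleftrightarrow> n - i \<in> Per q x"
proof -
  have "(\<forall>k. x (n - i) = x (n - i - k * int q)) \<longleftrightarrow> (\<forall>k. x (n - i) = x (n - i + k * int q))"
    (is "?L \<longleftrightarrow> ?R")
  proof
    assume ?L
    then have "x (n - i) = x (n - i - (- k) * int q)" for k by blast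
    then show ?R by simp
  next
    assume ?R
    then have "x (n - i) = x (n - i + (- k) * int q)" for k by blast
    then show ?L by simp
  qed
  then show ?thesis by (simp add: Per_def reflect_def algebra_simps)
qed

lemma finite_subset_Per:
  assumes "toeplitz_sequence x" "finite F"
  shows "\<exists>q>0. F \<subseteq> Per q x"
  using assms(2)
proof induction
  case empty
  show ?case by (rule exI[of _ 1]) simp
next
  case (insert i F)
  then obtain q where q: "q > 0" "F \<subseteq> Per q x" by blast
  obtain p where p: "p \<ge> 1" "i \<in> Per p x"
    using assms(1) unfolding toeplitz_sequence_def Per_def by blast
  have "p * q > 0" "insert i F \<subseteq> Per (p * q) x"
    using p q Per_mono[of p "p * q" x] Per_mono[of q "p * q" x] by auto
  then show ?case by blast
qed

text \<open>
  If \<open>[-n, n]\<close> consists of \<open>q\<close>-periodic positions of \<open>x\<close>, then this word recurs in \<open>x\<close> with gaps at most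
  \<open>q\<close>, so each sufficiently long window of \<open>y\<close> contains it.
\<close>

lemma toeplitz_orbit_closure_sym:
  assumes "toeplitz_sequence x" "y \<in> orbit_closure x"
  shows "x \<in> orbit_closure y"
proof (rule orbit_closureI)
  fix n :: int
  obtain q where q: "q > 0" "{-n..n} \<subseteq> Per q x"
    using finite_subset_Per[OF assms(1), of "{-n..n}"] by auto
  obtain t where t: "\<And>i. \<bar>i\<bar> \<le> n + int q \<Longrightarrow> y i = x (i + t)"
    using orbit_closureD[OF assms(2), of "n + int q"] by blast
  define s where "s = - (t mod int q)"
  have s: "\<bar>s\<bar> \<le> int q" "int q dvd s + t"
    using q(1) pos_mod_bound[of "int q" t] pos_mod_sign[of "int q" t]
    by (auto simp: s_def mod_eq_dvd_iff[symmetric] less_imp_le)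
  have "x i = y (i + s)" if "\<bar>i\<bar> \<le> n" for i
  proof -
    have "i \<in> Per q x" using that by (intro subsetD[OF q(2)]) auto
    moreover have "i - (i + s + t) = - (s + t)" by simp
    then have "int q dvd i - (i + s + t)" using s(2) by (simp only: dvd_minus_iff)
    ultimately have "x (i + s + t) = x i" by (rule Per_eq)
    then show ?thesis using t[of "i + s"] that s(1) by auto
  qed
  then show "\<exists>s. \<forall>i. \<bar>i\<bar> \<le> n \<longrightarrow> x i = y (i + s)" by blast
qed

lemma toeplitz_orbit_closure_minimal:
  assumes "toeplitz_sequence x" "y \<in> orbit_closure x"
  shows "orbit_closure y = orbit_closure x"
  using orbit_closure_trans toeplitz_orbit_closure_sym[OF assms] assms(2) by blast


section \<open>Detecting periodic positions in windows\<close>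

text \<open>
  If \<open>c\<close> is not \<open>p\<close>-periodic, there is a congruent position carrying a different letter. For the
  finitely many residues \<open>c\<close> modulo \<open>p\<close>, all these pairs of positions are \<open>q\<close>-periodic for one common
  multiple \<open>q\<close> of \<open>p\<close>, so copies of each pair appear with gaps \<open>q\<close>. Near any position of that residue
  class there are hence two congruent positions with different letters. The bound is inherited
  by the whole orbit closure since it concerns finite windows only.
\<close>

lemma Per_detection:
  assumes "toeplitz_sequence x" "p > 0"
  shows "\<exists>L. \<forall>y\<in>orbit_closure x. \<forall>i.
    (\<forall>j. \<bar>j - i\<bar> \<le> L \<and> int p dvd j - i \<longrightarrow> y j = y i) \<longrightarrow> i \<in> Per p y"
proof -
  define wit where "wit c = (SOME j. int p dvd j - c \<and> x j \<noteq> x c)" for c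
  have wit: "int p dvd wit c - c \<and> x (wit c) \<noteq> x c" if c: "c \<notin> Per p x" for c
  proof -
    obtain k where "x (c + k * int p) \<noteq> x c" using c unfolding Per_def mem_Collect_eq by metis
    then have "\<exists>j. int p dvd j - c \<and> x j \<noteq> x c" by (intro exI[of _ "c + k * int p"]) auto
    then show ?thesis unfolding wit_def by (rule someI_ex)
  qed
  let ?C = "{0..<int p}"
  obtain q0 where q0: "q0 > 0" "?C \<union> wit ` ?C \<subseteq> Per q0 x"
    using finite_subset_Per[OF assms(1), of "?C \<union> wit ` ?C"] by auto
  define q where "q = q0 * p"
  have q: "q > 0" "?C \<subseteq> Per q x" "wit ` ?C \<subseteq> Per q x" "p dvd q"
    using q0 assms(2) Per_mono[of q0 q x] by (auto simp: q_def)
  obtain B where B: "\<And>c. c \<in> ?C \<Longrightarrow> \<bar>wit c - c\<bar> \<le> B"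
  proof
    show "\<bar>wit c - c\<bar> \<le> Max ((\<lambda>c. \<bar>wit c - c\<bar>) ` ?C)" if "c \<in> ?C" for c
      using that by (intro Max_ge) auto
  qed
  define L where "L = B + int q"
  have x: "i \<in> Per p x" if H: "\<forall>j. \<bar>j - i\<bar> \<le> L \<and> int p dvd j - i \<longrightarrow> x j = x i" for i
  proof (rule ccontr)
    assume "i \<notin> Per p x"
    define c where "c = i mod int p"
    have c: "c \<in> ?C" "int p dvd i - c"
      using assms(2) by (auto simp: c_def)
    have "c \<notin> Per p x" using \<open>i \<notin> Per p x\<close> Per_cong_iff[OF c(2)] by blast
    note w = wit[OF this]
    \<comment> \<open>A shift by the multiple \<open>s\<close> of \<open>q\<close> brings the pair \<open>c\<close>, \<open>wit c\<close> close to \<open>i\<close>.\<close>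
    define s where "s = i - c - (i - c) mod int q"
    have s: "int q dvd s" "i - c - int q \<le> s" "s \<le> i - c"
      using q(1) by (auto simp: s_def less_imp_le)
    have ps: "int p dvd s" using s(1) q(4) by (meson dvd_trans int_dvd_int_iff)
    have e1: "x (c + s) = x c" using c(1) q(2) s(1) by (intro Per_eq[of c q]) auto
    have e2: "x (wit c + s) = x (wit c)" using c(1) q(3) s(1) by (intro Per_eq[of "wit c" q]) auto
    have "B \<ge> 0" using B[OF c(1)] by linarith
    have "x (c + s) = x i"
    proof (rule H[rule_format], intro conjI)
      show "\<bar>c + s - i\<bar> \<le> L" using s \<open>B \<ge> 0\<close> unfolding L_def by linarith
      have "c + s - i = s - (i - c)" by simp
      then show "int p dvd c + s - i" using dvd_diff[OF ps c(2)] by (simp only:)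
    qed
    moreover have "x (wit c + s) = x i"
    proof (rule H[rule_format], intro conjI)
      show "\<bar>wit c + s - i\<bar> \<le> L" using s B[OF c(1)] unfolding L_def by linarith
      have "wit c + s - i = (wit c - c) + s - (i - c)" by simp
      then show "int p dvd wit c + s - i"
        using dvd_diff[OF dvd_add[OF w[THEN conjunct1] ps] c(2)] by (simp only:)
    qed
    ultimately show False using e1 e2 w by simp
  qed
  have "i \<in> Per p y"
    if y: "y \<in> orbit_closure x" and H: "\<forall>j. \<bar>j - i\<bar> \<le> L \<and> int p dvd j - i \<longrightarrow> y j = y i" for y i
  proof -
    have "y (i + k * int p) = y i" for k
    proof -
      obtain t where t: "\<And>j. \<bar>j\<bar> \<le> \<bar>i\<bar> + \<bar>L\<bar> + \<bar>k * int p\<bar> \<Longrightarrow> y j = x (j + t)"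
        using orbit_closureD[OF y, of "\<bar>i\<bar> + \<bar>L\<bar> + \<bar>k * int p\<bar>"] by blast
      have "i + t \<in> Per p x"
      proof (rule x, intro allI impI)
        fix j assume j: "\<bar>j - (i + t)\<bar> \<le> L \<and> int p dvd j - (i + t)"
        have "\<bar>j - t\<bar> \<le> \<bar>i\<bar> + \<bar>L\<bar> + \<bar>k * int p\<bar>" using j by linarith
        then have "x (j - t + t) = y (j - t)" using t[of "j - t"] by simp
        also have "y (j - t) = y i" by (rule H[rule_format]) (use j in \<open>simp add: algebra_simps\<close>)
        also have "y i = x (i + t)" by (rule t) simp
        finally show "x j = x (i + t)" by simp
      qed
      then have "x (i + t + k * int p) = x (i + t)" by (rule PerD)
      then show ?thesis using t[of i] t[of "i + k * int p"]
        by (simp add: algebra_simps abs_triangle_ineq)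
    qed
    then show ?thesis by (simp add: Per_def)
  qed
  then show ?thesis by blast
qed

lemma skeleton_eqI:
  assumes "i \<in> Per q y \<longleftrightarrow> j \<in> Per q x" "i \<in> Per q y \<Longrightarrow> y i = x j"
  shows "skeleton q y i = skeleton q x j"
  using assms unfolding skeleton_def by simp

lemma skeleton_eqD:
  assumes "skeleton q y i = skeleton q x j"
  shows "i \<in> Per q y \<longleftrightarrow> j \<in> Per q x" "i \<in> Per q y \<Longrightarrow> y i = x j"
  using assms by (auto simp: skeleton_def split: if_splits)

lemma skeleton_cong:
  assumes "int q dvd i - j"
  shows "skeleton q x i = skeleton q x j"
  by (intro skeleton_eqI Per_cong_iff[OF assms]) (simp add: Per_eq[OF _ assms])

lemma skeleton_reflect: "skeleton q (reflect n x) i = skeleton q x (n - i)"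
  by (simp add: skeleton_def Per_reflect) (simp add: reflect_def)

text \<open>
  By \<open>Per_detection\<close>, a large window shows for each of \<open>p\<close> consecutive positions whether it is
  \<open>p\<close>-periodic; by periodicity, this determines the entire \<open>p\<close>-skeleton.
\<close>

lemma skeleton_local:
  assumes "toeplitz_sequence x" "p > 0"
  shows "\<exists>N. \<forall>y\<in>orbit_closure x. \<forall>z\<in>orbit_closure x. \<forall>i j. same_window N y i z j \<longrightarrow>
    (\<forall>d. skeleton p y (i + d) = skeleton p z (j + d))"
proof -
  obtain L where L: "\<And>y i. \<lbrakk>y \<in> orbit_closure x;
      \<forall>j. \<bar>j - i\<bar> \<le> L \<and> int p dvd j - i \<longrightarrow> y j = y i\<rbrakk> \<Longrightarrow> i \<in> Per p y"
    using Per_detection[OF assms] by blast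
  define N where "N = \<bar>L\<bar> + int p"
  have sub: "j + d \<in> Per p z"
    if "y \<in> orbit_closure x" "z \<in> orbit_closure x" and w: "same_window N y i z j"
      and d: "0 \<le> d" "d < int p" and m: "i + d \<in> Per p y" for y z i j d
  proof (rule L[OF that(2)], intro allI impI)
    fix e assume e: "\<bar>e - (j + d)\<bar> \<le> L \<and> int p dvd e - (j + d)"
    define f where "f = e - j"
    have f: "\<bar>f\<bar> \<le> N" "\<bar>d\<bar> \<le> N" using e d unfolding f_def N_def by linarith+
    have "z e = y (i + f)" using w f(1) by (simp add: same_window_def f_def)
    also have "\<dots> = y (i + d)"
      by (rule Per_eq[OF m]) (use e in \<open>auto simp: f_def algebra_simps dvd_diff_commute\<close>)
    also have "\<dots> = z (j + d)" using w f(2) by (simp add: same_window_def)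
    finally show "z e = z (j + d)" .
  qed
  have "skeleton p y (i + d) = skeleton p z (j + d)"
    if yz: "y \<in> orbit_closure x" "z \<in> orbit_closure x" and w: "same_window N y i z j" for y z i j d
  proof -
    define e where "e = d mod int p"
    have e: "0 \<le> e" "e < int p" "int p dvd d - e" using assms(2) by (auto simp: e_def)
    have w': "same_window N z j y i" using w by (simp add: same_window_def)
    have "\<bar>e\<bar> \<le> N" using e unfolding N_def by linarith
    then have "y (i + e) = z (j + e)" using w by (simp add: same_window_def)
    then have "skeleton p y (i + e) = skeleton p z (j + e)"
      using sub[OF yz w e(1,2)] sub[OF yz(2,1) w' e(1,2)] by (intro skeleton_eqI) auto
    moreover have "skeleton p y (i + d) = skeleton p y (i + e)"
      "skeleton p z (j + d) = skeleton p z (j + e)"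
      using e(3) by (auto intro!: skeleton_cong)
    ultimately show ?thesis by simp
  qed
  then show ?thesis by blast
qed

text \<open>
  A single large window of \<open>y\<close>, found somewhere in \<open>x\<close>, already determines the offset \<open>m\<close>.
\<close>

lemma skeleton_aligned:
  assumes "toeplitz_sequence x" "p > 0" "y \<in> orbit_closure x"
  shows "\<exists>m. \<forall>i. skeleton p y i = skeleton p x (i + m)"
proof -
  obtain N where N: "\<And>y z i j d. \<lbrakk>y \<in> orbit_closure x; z \<in> orbit_closure x; same_window N y i z j\<rbrakk> \<Longrightarrow>
      skeleton p y (i + d) = skeleton p z (j + d)"
    using skeleton_local[OF assms(1,2)] by blast
  obtain t where "same_window N y 0 x t" using assms(3) by (auto simp: orbit_closure_def)
  from N[OF assms(3) orbit_closure_refl this] show ?thesis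
    by (intro exI[of _ t]) (simp add: add.commute)
qed


section \<open>Essential periods and the scale\<close>

lemma essential_period_orbit_closure:
  assumes "toeplitz_sequence x" "y \<in> orbit_closure x"
  shows "essential_period p y \<longleftrightarrow> essential_period p x"
proof (cases "p > 0")
  case True
  obtain m where m: "\<And>i. skeleton p y i = skeleton p x (i + m)"
    using skeleton_aligned[OF assms(1) True assms(2)] by blast
  have "(\<forall>i. skeleton p y (i + int r) = skeleton p y i) \<longleftrightarrow>
        (\<forall>i. skeleton p x (i + int r) = skeleton p x i)" for r
  proof
    assume H: "\<forall>i. skeleton p y (i + int r) = skeleton p y i"
    have "skeleton p x (i + int r) = skeleton p x i" for i
      using H[rule_format, of "i - m"] m by (simp add: algebra_simps)
    then show "\<forall>i. skeleton p x (i + int r) = skeleton p x i" by blast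
  next
    assume H: "\<forall>i. skeleton p x (i + int r) = skeleton p x i"
    have "skeleton p y (i + int r) = skeleton p y i" for i
      using H[rule_format, of "i + m"] m by (simp add: algebra_simps)
    then show "\<forall>i. skeleton p y (i + int r) = skeleton p y i" by blast
  qed
  then show ?thesis by (simp add: essential_period_def)
next
  case False
  then show ?thesis by (simp add: essential_period_def)
qed

lemma sequence_scale_orbit_closure:
  assumes "toeplitz_sequence x" "y \<in> orbit_closure x"
  shows "sequence_scale y = sequence_scale x"
  using essential_period_orbit_closure[OF assms] by (simp add: sequence_scale_def)

text \<open>
  Equal windows at \<open>i\<close> and \<open>j\<close> make \<open>i - j\<close> a period of the \<open>p\<close>-skeleton, and by minimality of \<open>p\<close> every
  period of the \<open>p\<close>-skeleton is a multiple of \<open>p\<close>.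
\<close>

lemma essential_period_recognizable:
  assumes "toeplitz_sequence x" "essential_period p x"
  shows "\<exists>N. \<forall>y\<in>orbit_closure x. \<forall>i j. same_window N y i y j \<longrightarrow> int p dvd i - j"
proof -
  have p: "p > 0" using assms(2) by (simp add: essential_period_def)
  obtain N where N: "\<And>y z i j d. \<lbrakk>y \<in> orbit_closure x; z \<in> orbit_closure x; same_window N y i z j\<rbrakk> \<Longrightarrow>
      skeleton p y (i + d) = skeleton p z (j + d)"
    using skeleton_local[OF assms(1) p] by blast
  have "int p dvd i - j" if y: "y \<in> orbit_closure x" and w: "same_window N y i y j" for y i j
  proof (rule ccontr)
    assume "\<not> int p dvd i - j"
    define r where "r = nat ((i - j) mod int p)"
    have r: "int r = (i - j) mod int p" using p by (simp add: r_def)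
    have r0: "0 < r" "r < p"
      using \<open>\<not> int p dvd i - j\<close> p pos_mod_bound[of "int p" "i - j"]
        pos_mod_sign[of "int p" "i - j"] unfolding r[symmetric] dvd_eq_mod_eq_0 by linarith+
    have "skeleton p y (d + int r) = skeleton p y d" for d
    proof -
      have "skeleton p y (d + int r) = skeleton p y (d + (i - j))"
        by (rule skeleton_cong) (simp add: r mod_eq_dvd_iff[symmetric])
      also have "\<dots> = skeleton p y d"
        using N[OF y y w, of "d - j"] by (simp add: algebra_simps)
      finally show ?thesis .
    qed
    then have "\<not> essential_period p y" using r0 by (auto simp: essential_period_def)
    then show False using assms essential_period_orbit_closure[OF assms(1) y] by simp
  qed
  then show ?thesis by blast
qed

text \<open>
  The least period \<open>r\<close> of the \<open>p\<close>-skeleton divides \<open>p\<close>, and the \<open>r\<close>-skeleton is equal to the \<open>p\<close>-skeleton, so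
  that \<open>r\<close> is essential.
\<close>

lemma ex_essential_period:
  assumes "i \<in> Per p x" "p > 0"
  shows "\<exists>r. essential_period r x \<and> i \<in> Per r x"
proof -
  define P where "P r \<longleftrightarrow> r > 0 \<and> (\<forall>i. skeleton p x (i + int r) = skeleton p x i)" for r
  have "P p" unfolding P_def using assms(2) by (auto intro!: skeleton_cong)
  define r where "r = (LEAST r. P r)"
  have "P r" unfolding r_def by (rule LeastI[of P, OF \<open>P p\<close>])
  have least: "\<not> P s" if "s < r" for s using that not_less_Least unfolding r_def by blast
  have mult: "skeleton p x (i + int (n * r)) = skeleton p x i" for i n
  proof (induction n)
    case (Suc n)
    have "skeleton p x (i + int (Suc n * r)) = skeleton p x (i + int (n * r) + int r)"
      by (simp add: algebra_simps)
    then show ?case using Suc \<open>P r\<close> by (simp add: P_def)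
  qed simp
  have multi: "skeleton p x (i + k * int r) = skeleton p x i" for i k
  proof (cases "k \<ge> 0")
    case True
    then show ?thesis using mult[of i "nat k"] by simp
  next
    case False
    then show ?thesis using mult[of "i + k * int r" "nat (-k)"] by (simp add: algebra_simps)
  qed
  have "skeleton p x (i + int (p mod r)) = skeleton p x i" for i
  proof -
    have "int (p mod r) = int p + (- int (p div r)) * int r"
      by (simp add: zmod_int zdiv_int minus_div_mult_eq_mod[symmetric])
    then have "skeleton p x (i + int (p mod r)) = skeleton p x (i + int p)"
      using multi[of "i + int p" "- int (p div r)"] by (simp only: add.assoc)
    then show ?thesis using \<open>P p\<close> by (simp add: P_def)
  qed
  then have "r dvd p" using least[of "p mod r"] \<open>P r\<close> by (auto simp: P_def)
  have Per: "Per r x = Per p x"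
  proof
    show "Per r x \<subseteq> Per p x" using \<open>r dvd p\<close> by (rule Per_mono)
    show "Per p x \<subseteq> Per r x"
    proof
      fix i assume i: "i \<in> Per p x"
      have "x (i + k * int r) = x i" for k
        using skeleton_eqD(2)[OF multi[of i k, symmetric] i] by simp
      then show "i \<in> Per r x" by (simp add: Per_def)
    qed
  qed
  then have "skeleton r x = skeleton p x" by (simp add: skeleton_def fun_eq_iff)
  then have "essential_period r x" using \<open>P r\<close> least by (auto simp: essential_period_def P_def)
  then show ?thesis using Per assms(1) by blast
qed

lemma supernatural_dvd_lcm:
  assumes "a > 0" "b > 0" "supernatural_dvd (supernatural_of_nat a) u"
    "supernatural_dvd (supernatural_of_nat b) u"
  shows "supernatural_dvd (supernatural_of_nat (lcm a b)) u"
  using assms by (auto simp: supernatural_dvd_def supernatural_of_nat_def multiplicity_lcm max_def)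

lemma essential_period_dvd_scale:
  "essential_period p x \<Longrightarrow> supernatural_dvd (supernatural_of_nat p) (sequence_scale x)"
  by (auto simp: supernatural_dvd_def sequence_scale_def supernatural_Lcm_def intro!: SUP_upper)

lemma finite_subset_Per_scale:
  assumes "toeplitz_sequence x" "finite F"
  shows "\<exists>q>0. supernatural_dvd (supernatural_of_nat q) (sequence_scale x) \<and> F \<subseteq> Per q x"
  using assms(2)
proof induction
  case empty
  show ?case
    by (rule exI[of _ 1])
       (simp add: supernatural_dvd_def supernatural_of_nat_def zero_enat_def[symmetric])
next
  case (insert i F)
  then obtain q where q: "q > 0" "supernatural_dvd (supernatural_of_nat q) (sequence_scale x)"
    "F \<subseteq> Per q x" by blast
  obtain p' where "p' \<ge> 1" "i \<in> Per p' x"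
    using assms(1) unfolding toeplitz_sequence_def Per_def by blast
  then obtain p where p: "essential_period p x" "i \<in> Per p x"
    using ex_essential_period[of i p' x] by auto
  have p0: "p > 0" using p(1) by (simp add: essential_period_def)
  have "supernatural_dvd (supernatural_of_nat (lcm p q)) (sequence_scale x)"
    using p0 q(1) essential_period_dvd_scale[OF p(1)] q(2) by (rule supernatural_dvd_lcm)
  moreover have "insert i F \<subseteq> Per (lcm p q) x"
    using p q Per_mono[of p "lcm p q" x] Per_mono[of q "lcm p q" x] by auto
  moreover have "lcm p q > 0" using p0 q(1) by (simp add: lcm_pos_nat)
  ultimately show ?case by blast
qed

text \<open>
  As the scale is a supremum of exponents and the exponents of \<open>p\<close> are finite, every prime power
  dividing \<open>p\<close> divides an essential period. Finitely many essential periods thus suffice to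
  recognize positions modulo \<open>p\<close>.
\<close>

lemma scale_divisor_recognizable:
  assumes "toeplitz_sequence x" "p > 0" "supernatural_dvd (supernatural_of_nat p) (sequence_scale x)"
  shows "\<exists>N. \<forall>y\<in>orbit_closure x. \<forall>i j. same_window N y i y j \<longrightarrow> int p dvd i - j"
proof -
  have ess: "\<exists>e. essential_period e x \<and> multiplicity r p \<le> multiplicity r e"
    if r: "r \<in> prime_factors p" for r
  proof (rule ccontr)
    assume none: "\<nexists>e. essential_period e x \<and> multiplicity r p \<le> multiplicity r e"
    have r': "prime r" "multiplicity r p > 0"
      using r assms(2) by (auto simp: prime_factors_multiplicity)
    have "enat (multiplicity r p) \<le> sequence_scale x r"
      using assms(3) r'(1) by (simp add: supernatural_dvd_def supernatural_of_nat_def)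
    also have "\<dots> \<le> enat (multiplicity r p - 1)"
      unfolding sequence_scale_def supernatural_Lcm_def
    proof (rule SUP_least)
      fix w assume "w \<in> supernatural_of_nat ` {p. essential_period p x}"
      then obtain e where e: "w = supernatural_of_nat e" "essential_period e x" by blast
      then have "multiplicity r e < multiplicity r p" using none by (meson not_le)
      then show "w r \<le> enat (multiplicity r p - 1)"
        using e r'(1) by (simp add: supernatural_of_nat_def)
    qed
    finally show False using r'(2) by simp
  qed
  define Q where "Q r N \<longleftrightarrow> (\<exists>e. multiplicity r p \<le> multiplicity r e \<and> e > 0 \<and>
      (\<forall>y\<in>orbit_closure x. \<forall>i j. same_window N y i y j \<longrightarrow> int e dvd i - j))" for r N
  have "\<exists>N. Q r N" if r: "r \<in> prime_factors p" for r
  proof -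
    obtain e where e: "essential_period e x" "multiplicity r p \<le> multiplicity r e"
      using ess[OF r] by blast
    moreover have "e > 0" using e(1) by (simp add: essential_period_def)
    ultimately show ?thesis
      unfolding Q_def using essential_period_recognizable[OF assms(1) e(1)] by blast
  qed
  then have "\<forall>r\<in>prime_factors p. \<exists>N. Q r N" by blast
  from bchoice[OF this] obtain N where N: "\<And>r. r \<in> prime_factors p \<Longrightarrow> Q r (N r)" by blast
  define M where "M = Max (insert 0 (N ` prime_factors p))"
  have M: "N r \<le> M" if "r \<in> prime_factors p" for r
    unfolding M_def using that by (intro Max_ge) auto
  have "int p dvd i - j" if y: "y \<in> orbit_closure x" and w: "same_window M y i y j" for y i j
  proof (cases "i = j")
    case neq: False
    have "p dvd nat \<bar>i - j\<bar>"
    proof (rule multiplicity_le_imp_dvd)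
      show "p \<noteq> 0" using assms(2) by simp
    next
      fix r :: nat assume "prime r"
      show "multiplicity r p \<le> multiplicity r (nat \<bar>i - j\<bar>)"
      proof (cases "r \<in> prime_factors p")
        case True
        obtain e where e: "multiplicity r p \<le> multiplicity r e" "e > 0"
          "\<And>y i j. y \<in> orbit_closure x \<Longrightarrow> same_window (N r) y i y j \<Longrightarrow> int e dvd i - j"
          using N[OF True] unfolding Q_def by blast
        have "int e dvd i - j" by (rule e(3)[OF y same_window_mono[OF w M[OF True]]])
        then have "e dvd nat \<bar>i - j\<bar>" by simp
        then have "multiplicity r e \<le> multiplicity r (nat \<bar>i - j\<bar>)"
          using neq by (intro dvd_imp_multiplicity_le) auto
        then show ?thesis using e(1) by linarith
      next
        case False
        then have "multiplicity r p = 0"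
          using \<open>prime r\<close> assms(2) by (auto simp: prime_factors_multiplicity)
        then show ?thesis by simp
      qed
    qed
    then show ?thesis by simp
  qed simp
  then show ?thesis by blast
qed


section \<open>The topology of the full shift\<close>

lemma openin_cylinder: "openin full_shift {y. same_window n y 0 c 0}"
proof -
  have "openin full_shift {y \<in> topspace full_shift. y i \<in> {c i}}" for i :: int
    by (rule openin_continuous_map_preimage[where Y = "discrete_topology UNIV"])
       (use continuous_map_product_projection[of i UNIV "\<lambda>_. discrete_topology UNIV"]
         in \<open>simp_all add: full_shift_def\<close>)
  then have op: "openin full_shift {y. y i = c i}" for i by simp
  have "openin full_shift (\<Inter>i\<in>{-n..n}. {y. y i = c i} \<inter> topspace full_shift)" if "n \<ge> 0"
    using that op by (intro openin_Inter) auto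
  moreover have "{y. same_window n y 0 c 0} = (\<Inter>i\<in>{-n..n}. {y. y i = c i} \<inter> topspace full_shift)"
    if "n \<ge> 0" using that by (force simp: same_window_def abs_le_iff)
  moreover have "{y. same_window n y 0 c 0} = topspace full_shift" if "n < 0"
    using that by (auto simp: same_window_def)
  ultimately show ?thesis
    using openin_topspace[of full_shift] by (cases "n \<ge> 0") simp_all
qed

lemma openin_imp_cylinder:
  assumes "openin full_shift U" "y \<in> U"
  shows "\<exists>n. {y'. same_window n y' 0 y 0} \<subseteq> U"
proof -
  obtain V where V: "finite {i. V i \<noteq> UNIV}" "y \<in> Pi\<^sub>E UNIV V" "Pi\<^sub>E UNIV V \<subseteq> U"
    using assms unfolding full_shift_def openin_product_topology_alt by auto
  obtain n where n: "\<And>i. V i \<noteq> UNIV \<Longrightarrow> \<bar>i\<bar> \<le> n"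
  proof
    show "\<bar>i\<bar> \<le> Max (abs ` {i. V i \<noteq> UNIV})" if "V i \<noteq> UNIV" for i
      using that V(1) by (intro Max_ge) auto
  qed
  have "y' \<in> Pi\<^sub>E UNIV V" if "same_window n y' 0 y 0" for y'
  proof -
    have "y' i \<in> V i" for i
      using that n[of i] V(2) by (cases "V i = UNIV") (auto simp: same_window_def PiE_iff)
    then show ?thesis by (simp add: PiE_iff)
  qed
  then show ?thesis using V(3) by blast
qed

lemma shift_orbit_eq: "shift_orbit x = range (\<lambda>t. translate t x)"
proof -
  have 1: "(shift ^^ n) x = translate (int n) x" for n
    by (induction n) (auto simp: shift_def translate_def algebra_simps)
  have 2: "(inv shift ^^ n) x = translate (- int n) x" for n
    by (induction n) (auto simp: inv_shift translate_def algebra_simps)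
  have "(\<Union>n::nat. {translate (int n) x, translate (- int n) x}) = range (\<lambda>t. translate t x)"
  proof (intro equalityI subsetI)
    fix y assume "y \<in> range (\<lambda>t. translate t x)"
    then obtain t where t: "y = translate t x" by blast
    show "y \<in> (\<Union>n::nat. {translate (int n) x, translate (- int n) x})"
      by (cases t rule: int_cases2) (use t in auto)
  qed auto
  then show ?thesis by (simp add: shift_orbit_def 1 2)
qed

lemma closure_of_shift_orbit: "full_shift closure_of shift_orbit x = orbit_closure x"
proof (intro equalityI subsetI)
  fix y assume y: "y \<in> full_shift closure_of shift_orbit x"
  show "y \<in> orbit_closure x" unfolding orbit_closure_def mem_Collect_eq
  proof
    fix n
    have "y \<in> {y'. same_window n y' 0 y 0}" by (simp add: same_window_def)
    with y[unfolded in_closure_of, THEN conjunct2, rule_format, of "{y'. same_window n y' 0 y 0}"]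
    obtain t where "same_window n (translate t x) 0 y 0"
      unfolding shift_orbit_eq by (auto simp: openin_cylinder)
    then show "\<exists>t. same_window n y 0 x t"
      by (auto simp: same_window_translate_0)
  qed
next
  fix y assume y: "y \<in> orbit_closure x"
  show "y \<in> full_shift closure_of shift_orbit x"
    unfolding in_closure_of
  proof (intro conjI allI impI)
    fix U assume U: "y \<in> U \<and> openin full_shift U"
    then obtain n where n: "{y'. same_window n y' 0 y 0} \<subseteq> U"
      using openin_imp_cylinder by blast
    obtain t where "same_window n y 0 x t" using y by (auto simp: orbit_closure_def)
    then have "same_window n (translate t x) 0 y 0"
      by (auto simp: same_window_translate_0)
    then show "\<exists>y'. y' \<in> shift_orbit x \<and> y' \<in> U" using n unfolding shift_orbit_eq by blast
  qed simp
qed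

lemma closedin_orbit_closure: "closedin full_shift (orbit_closure x)"
  unfolding closure_of_shift_orbit[symmetric] by simp

lemma compact_full_shift: "compact_space (full_shift :: (int \<Rightarrow> 'a::finite) topology)"
  unfolding full_shift_def by (simp add: compact_space_product_topology compact_space_discrete_topology)

text \<open>
  Otherwise each \<open>w\<close> would have a cylinder neighbourhood visited by only finitely many terms, and
  by compactness finitely many of these neighbourhoods cover all terms.
\<close>

lemma cluster_point:
  fixes f :: "nat \<Rightarrow> int \<Rightarrow> 'a::finite"
  shows "\<exists>w. \<forall>n. infinite {K. same_window n (f K) 0 w 0}"
proof (rule ccontr)
  assume "\<not> ?thesis"
  then obtain n where n: "\<And>w. finite {K. same_window (n w) (f K) 0 w 0}"
    by metis
  define C where "C w = {y. same_window (n w) y 0 w 0}" for w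
  have "\<exists>\<F>. finite \<F> \<and> \<F> \<subseteq> range C \<and> topspace full_shift \<subseteq> \<Union>\<F>"
  proof (rule compactinD)
    show "compactin full_shift (topspace full_shift)"
      using compact_full_shift by (simp add: compact_space_def)
    show "openin full_shift U" if "U \<in> range C" for U
      using that openin_cylinder by (auto simp: C_def)
    show "topspace full_shift \<subseteq> \<Union> (range C)"
      by (auto simp: C_def same_window_def)
  qed
  then obtain \<F> where F: "finite \<F>" "\<F> \<subseteq> range C" "topspace full_shift \<subseteq> \<Union>\<F>" by blast
  from finite_subset_image[OF F(1,2)] obtain W where "finite W" "\<F> = C ` W" by blast
  with F(3) have W: "finite W" "topspace full_shift \<subseteq> \<Union> (C ` W)" by simp_all
  have "(UNIV :: nat set) \<subseteq> (\<Union>w\<in>W. {K. same_window (n w) (f K) 0 w 0})"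
  proof
    fix K
    have "f K \<in> \<Union> (C ` W)" using W(2) by auto
    then show "K \<in> (\<Union>w\<in>W. {K. same_window (n w) (f K) 0 w 0})" by (auto simp: C_def)
  qed
  moreover have "finite (\<Union>w\<in>W. {K. same_window (n w) (f K) 0 w 0})" using W(1) n by blast
  ultimately show False using finite_subset infinite_UNIV_nat by blast
qed

lemma cluster_point_late:
  assumes "infinite {K::nat. same_window n (f K) 0 w 0}"
  shows "\<exists>K\<ge>m. same_window n (f K) 0 w 0"
  using assms unfolding infinite_nat_iff_unbounded_le by auto

text \<open>
  If \<open>f\<close> took distinct values at points agreeing on larger and larger windows, these pairs of points
  would cluster at a single point of \<open>X\<close>, near which \<open>f\<close> is constant. This is the topological part of the
  Curtis--Hedlund--Lyndon theorem.
\<close>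

lemma continuous_into_discrete_local:
  fixes f :: "(int \<Rightarrow> 'a::finite) \<Rightarrow> 'b"
  assumes X: "closedin full_shift X"
    and f: "continuous_map (subtopology full_shift X) (discrete_topology UNIV) f"
  shows "\<exists>n. \<forall>y\<in>X. \<forall>z\<in>X. same_window n y 0 z 0 \<longrightarrow> f y = f z"
proof (rule ccontr)
  assume "\<not> ?thesis"
  then have "\<forall>n::nat. \<exists>y z. y \<in> X \<and> z \<in> X \<and> same_window (int n) y 0 z 0 \<and> f y \<noteq> f z"
    by blast
  then obtain y z where yz: "\<And>n. y n \<in> X" "\<And>n. z n \<in> X" "\<And>n. same_window (int n) (y n) 0 (z n) 0"
    "\<And>n. f (y n) \<noteq> f (z n)" by metis
  obtain w where w: "\<And>n. infinite {K. same_window n (y K) 0 w 0}"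
    using cluster_point[of y] by blast
  have "w \<in> full_shift closure_of X" unfolding in_closure_of
  proof (intro conjI allI impI)
    fix U assume "w \<in> U \<and> openin full_shift U"
    then obtain n where n: "{y'. same_window n y' 0 w 0} \<subseteq> U"
      using openin_imp_cylinder by blast
    show "\<exists>y'. y' \<in> X \<and> y' \<in> U" using cluster_point_late[OF w[of n]] n yz(1) by blast
  qed simp
  then have "w \<in> X" using X by (simp add: closure_of_closedin)
  have "openin (subtopology full_shift X) {y \<in> topspace (subtopology full_shift X). f y \<in> {f w}}"
    by (rule openin_continuous_map_preimage[OF f]) simp
  then obtain U where U: "openin full_shift U" "{y \<in> X. f y = f w} = U \<inter> X"
    by (auto simp: openin_subtopology)
  then have "w \<in> U" using \<open>w \<in> X\<close> by blast
  then obtain n where n: "{y'. same_window n y' 0 w 0} \<subseteq> U"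
    using openin_imp_cylinder[OF U(1)] by blast
  obtain K where K: "K \<ge> nat n" "same_window n (y K) 0 w 0"
    using cluster_point_late[OF w] by blast
  have "same_window n (y K) 0 (z K) 0"
    using same_window_mono[OF yz(3)[of K], of n] K(1) by linarith
  then have "same_window n (z K) 0 (y K) 0" by (subst same_window_commute)
  then have "same_window n (z K) 0 w 0" using K(2) by (rule same_window_trans)
  then have "y K \<in> U \<inter> X" "z K \<in> U \<inter> X" using n K(2) yz(1,2) by blast+
  then have "f (y K) = f w" "f (z K) = f w" using U(2) by blast+
  then show False using yz(4)[of K] by simp
qed

lemma local_imp_continuous:
  assumes "\<And>y z. same_window n y 0 z 0 \<Longrightarrow> f y = f z"
  shows "continuous_map full_shift (discrete_topology UNIV) f"
  unfolding continuous_map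
proof (intro conjI allI impI)
  fix U
  show "openin full_shift {y \<in> topspace full_shift. f y \<in> U}"
  proof (subst openin_subopen, intro ballI)
    fix y assume "y \<in> {y \<in> topspace full_shift. f y \<in> U}"
    then have "{z. same_window n z 0 y 0} \<subseteq> {y \<in> topspace full_shift. f y \<in> U}"
      using assms by auto
    moreover have "y \<in> {z. same_window n z 0 y 0}" by (simp add: same_window_def)
    ultimately show "\<exists>T. openin full_shift T \<and> y \<in> T \<and> T \<subseteq> {y \<in> topspace full_shift. f y \<in> U}"
      using openin_cylinder by blast
  qed
qed simp


section \<open>Conjugacies as local rules\<close>

text \<open>
  The letters of \<open>w\<close> are given by a local rule of radius \<open>N\<close> applied to \<open>x\<close>. In terms of subshifts, a
  sliding block code maps \<open>x\<close> to \<open>w\<close>.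
\<close>

definition locally_derives :: "int \<Rightarrow> (int \<Rightarrow> 'a) \<Rightarrow> (int \<Rightarrow> 'b) \<Rightarrow> bool" where
  "locally_derives N x w \<longleftrightarrow> (\<forall>i j. same_window N x i x j \<longrightarrow> w i = w j)"

lemma locally_derives_mono: "locally_derives N x w \<Longrightarrow> N \<le> M \<Longrightarrow> locally_derives M x w"
  unfolding locally_derives_def using same_window_mono by blast

text \<open>
  The sliding block code that maps \<open>x\<close> to \<open>w\<close>. On windows not occurring in \<open>x\<close> its value is arbitrary.
\<close>

definition block_code :: "int \<Rightarrow> (int \<Rightarrow> 'a) \<Rightarrow> (int \<Rightarrow> 'b) \<Rightarrow> (int \<Rightarrow> 'a) \<Rightarrow> (int \<Rightarrow> 'b)" where
  "block_code N x w y = (\<lambda>i. w (SOME j. same_window N y i x j))"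

lemma block_code_eq:
  assumes "locally_derives N x w" "same_window N y i x j"
  shows "block_code N x w y i = w j"
proof -
  have "same_window N y i x (SOME j. same_window N y i x j)"
    using assms(2) by (rule someI)
  then have "same_window N x (SOME j. same_window N y i x j) y i"
    using same_window_commute by blast
  from same_window_trans[OF this assms(2)]
  show ?thesis using assms(1) unfolding block_code_def locally_derives_def by blast
qed

lemma block_code_cong:
  "same_window N y i z k \<Longrightarrow> block_code N x w y i = block_code N x w z k"
  unfolding block_code_def same_window_def by simp

lemma block_code_window:
  assumes "locally_derives N x w" "y \<in> orbit_closure x"
  shows "\<exists>t. \<forall>i. \<bar>i\<bar> \<le> n \<longrightarrow> y i = x (i + t) \<and> block_code N x w y i = w (i + t)"
proof -
  obtain t where t: "\<And>i. \<bar>i\<bar> \<le> n + \<bar>N\<bar> \<Longrightarrow> y i = x (i + t)"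
    using orbit_closureD[OF assms(2), of "n + \<bar>N\<bar>"] by blast
  have "block_code N x w y i = w (i + t)" if "\<bar>i\<bar> \<le> n" for i
  proof (rule block_code_eq[OF assms(1)])
    show "same_window N y i x (i + t)" unfolding same_window_def
    proof (intro allI impI)
      fix d :: int assume "\<bar>d\<bar> \<le> N"
      then have "\<bar>i + d\<bar> \<le> n + \<bar>N\<bar>" using that by linarith
      from t[OF this] show "y (i + d) = x (i + t + d)" by (simp add: algebra_simps)
    qed
  qed
  then show ?thesis using t by (intro exI[of _ t]) auto
qed

lemma block_code_in_orbit_closure:
  assumes "locally_derives N x w" "y \<in> orbit_closure x"
  shows "block_code N x w y \<in> orbit_closure w"
proof (rule orbit_closureI)
  fix n
  show "\<exists>t. \<forall>i. \<bar>i\<bar> \<le> n \<longrightarrow> block_code N x w y i = w (i + t)"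
    using block_code_window[OF assms, of n] by blast
qed

lemma block_code_inverse:
  assumes "locally_derives N x w" "locally_derives N w x" "y \<in> orbit_closure x"
  shows "block_code N w x (block_code N x w y) = y"
proof
  fix i
  obtain t where t: "\<forall>j. \<bar>j\<bar> \<le> \<bar>i\<bar> + \<bar>N\<bar> \<longrightarrow> y j = x (j + t) \<and> block_code N x w y j = w (j + t)"
    using block_code_window[OF assms(1,3), of "\<bar>i\<bar> + \<bar>N\<bar>"] by blast
  have "same_window N (block_code N x w y) i w (i + t)" unfolding same_window_def
  proof (intro allI impI)
    fix d :: int assume "\<bar>d\<bar> \<le> N"
    then have "\<bar>i + d\<bar> \<le> \<bar>i\<bar> + \<bar>N\<bar>" by linarith
    then show "block_code N x w y (i + d) = w (i + t + d)" using t by (simp add: algebra_simps)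
  qed
  then have "block_code N w x (block_code N x w y) i = x (i + t)"
    by (rule block_code_eq[OF assms(2)])
  then show "block_code N w x (block_code N x w y) i = y i" using t by simp
qed

text \<open>
  The conjugacy is the sliding block code from \<open>x\<close> to \<open>w\<close>, followed by the reflection at \<open>0\<close>. It maps \<open>X\<close>
  to the orbit closure of the reflection of \<open>w\<close>, which is \<open>X\<close> again by minimality.
\<close>

lemma conjugate_of_locally_derives:
  fixes x :: "int \<Rightarrow> 'a::finite"
  assumes x: "toeplitz_sequence x" and w: "reflect 0 w \<in> orbit_closure x"
    and xw: "locally_derives N x w" and wx: "locally_derives N w x"
  defines "X \<equiv> orbit_closure x"
  shows "conjugate (subtopology full_shift X) shift (subtopology full_shift X) (inv shift)"
proof -
  define \<phi> where "\<phi> y = reflect 0 (block_code N x w y)" for y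
  define \<psi> where "\<psi> y = block_code N w x (reflect 0 y)" for y
  have X: "orbit_closure (reflect 0 w) = X"
    unfolding X_def by (rule toeplitz_orbit_closure_minimal[OF x w])
  have \<phi>X: "\<phi> y \<in> X" if "y \<in> X" for y
    using orbit_closure_reflect[OF block_code_in_orbit_closure[OF xw]] that X
    unfolding \<phi>_def X_def by blast
  have refl: "reflect 0 y \<in> orbit_closure w" if "y \<in> X" for y
    using orbit_closure_reflect[of y "reflect 0 w"] that X by simp
  have \<psi>X: "\<psi> y \<in> X" if "y \<in> X" for y
    using block_code_in_orbit_closure[OF wx refl[OF that]] unfolding \<psi>_def X_def .
  have "\<psi> (\<phi> y) = y" if "y \<in> X" for y
    using block_code_inverse[OF xw wx] that unfolding \<phi>_def \<psi>_def X_def by simp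
  moreover have "\<phi> (\<psi> y) = y" if "y \<in> X" for y
    using block_code_inverse[OF wx xw refl[OF that]] unfolding \<phi>_def \<psi>_def by simp
  moreover have "continuous_map full_shift (discrete_topology UNIV) (\<lambda>y. \<phi> y i)" for i
  proof (rule local_imp_continuous[of "\<bar>N\<bar> + \<bar>i\<bar>"])
    fix y z :: "int \<Rightarrow> 'a" assume "same_window (\<bar>N\<bar> + \<bar>i\<bar>) y 0 z 0"
    then have "same_window N y (- i) z (- i)" by (auto simp: same_window_def)
    then have "block_code N x w y (- i) = block_code N x w z (- i)" by (rule block_code_cong)
    then show "\<phi> y i = \<phi> z i" by (simp add: \<phi>_def reflect_def)
  qed
  then have "continuous_map full_shift full_shift \<phi>"
    unfolding full_shift_def continuous_map_componentwise_UNIV by blast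
  moreover have "continuous_map full_shift (discrete_topology UNIV) (\<lambda>y. \<psi> y i)" for i
  proof (rule local_imp_continuous[of "\<bar>N\<bar> + \<bar>i\<bar>"])
    fix y z :: "int \<Rightarrow> 'a" assume "same_window (\<bar>N\<bar> + \<bar>i\<bar>) y 0 z 0"
    then have "same_window N y (- i) z (- i)" by (auto simp: same_window_def)
    then have "same_window N (reflect 0 y) i (reflect 0 z) i" by (simp add: same_window_reflect)
    then show "\<psi> y i = \<psi> z i" unfolding \<psi>_def by (rule block_code_cong)
  qed
  then have "continuous_map full_shift full_shift \<psi>"
    unfolding full_shift_def continuous_map_componentwise_UNIV by blast
  ultimately have "homeomorphic_maps (subtopology full_shift X) (subtopology full_shift X) \<phi> \<psi>"
    using \<phi>X \<psi>X unfolding homeomorphic_maps_def continuous_map_in_subtopology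
    by (simp add: continuous_map_from_subtopology image_subset_iff)
  then have "homeomorphic_map (subtopology full_shift X) (subtopology full_shift X) \<phi>"
    by (rule homeomorphic_maps_imp_map)
  moreover have "\<phi> (shift y) = inv shift (\<phi> y)" for y
  proof
    fix i
    have "same_window N (shift y) (- i) y (1 - i)"
      by (simp add: same_window_def shift_def algebra_simps)
    then have "block_code N x w (shift y) (- i) = block_code N x w y (1 - i)"
      by (rule block_code_cong)
    then show "\<phi> (shift y) i = inv shift (\<phi> y) i"
      by (simp add: inv_shift \<phi>_def reflect_def)
  qed
  ultimately show ?thesis unfolding conjugate_def by blast
qed

text \<open>
  For a conjugacy \<open>\<phi>\<close>, the sequence \<open>w\<close> is the reflection of \<open>\<phi> x\<close>. Its letters are \<open>w i = \<phi> (S\<^sup>i x) 0\<close>, and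
  the map \<open>y \<mapsto> \<phi> y 0\<close> depends on a finite window of \<open>y\<close> only. The inverse of \<open>\<phi>\<close> is treated alike.
\<close>

lemma locally_derives_of_conjugate:
  fixes x :: "int \<Rightarrow> 'a::finite"
  defines "X \<equiv> orbit_closure x"
  assumes "conjugate (subtopology full_shift X) shift (subtopology full_shift X) (inv shift)"
  shows "\<exists>w N. reflect 0 w \<in> X \<and> locally_derives N x w \<and> locally_derives N w x"
proof -
  let ?T = "subtopology full_shift X"
  have X[simp]: "topspace ?T = X" by simp
  obtain \<phi> \<psi> where hom: "homeomorphic_maps ?T ?T \<phi> \<psi>"
    and comm: "\<And>y. y \<in> X \<Longrightarrow> \<phi> (shift y) = inv shift (\<phi> y)"
    using assms(2) unfolding conjugate_def homeomorphic_map_maps X by blast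
  have cont: "continuous_map ?T ?T \<phi>" "continuous_map ?T ?T \<psi>"
    and inv: "\<And>y. y \<in> X \<Longrightarrow> \<psi> (\<phi> y) = y"
    using hom unfolding homeomorphic_maps_def X by blast+
  have tX: "translate t x \<in> X" for t
    unfolding X_def by (intro translate_in_orbit_closure orbit_closure_refl)
  define z where "z = \<phi> x"
  have zX: "z \<in> X" using cont(1) tX[of 0] unfolding z_def continuous_map
    by (auto simp: translate_0)
  have \<phi>t: "\<phi> (translate t x) = translate (- t) z" for t
  proof (induction t rule: int_induct[of _ 0])
    case base
    show ?case by (simp add: z_def translate_0)
  next
    case (step1 t)
    have "translate (t + 1) x = shift (translate t x)"
      by (simp add: translate_def shift_def algebra_simps)
    then show ?case using comm[OF tX[of t]] step1
      by (simp add: inv_shift translate_def algebra_simps)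
  next
    case (step2 t)
    have "translate t x = shift (translate (t - 1) x)"
      by (simp add: translate_def shift_def algebra_simps)
    then have "inv shift (\<phi> (translate (t - 1) x)) = translate (- t) z"
      using comm[OF tX[of "t - 1"]] step2 by simp
    then have "inv shift (\<phi> (translate (t - 1) x)) (i + 1) = translate (- t) z (i + 1)" for i
      by simp
    then show ?case by (simp add: inv_shift translate_def fun_eq_iff algebra_simps)
  qed
  define w where "w = reflect 0 z"
  have cont0: "continuous_map ?T (discrete_topology UNIV) (\<lambda>y. f y 0)"
    if "continuous_map ?T ?T f" for f
    using that unfolding continuous_map_in_subtopology
    by (auto simp: full_shift_def continuous_map_componentwise_UNIV)
  have closed: "closedin full_shift X" unfolding X_def by (rule closedin_orbit_closure)
  obtain N where N: "\<And>y y'. \<lbrakk>y \<in> X; y' \<in> X; same_window N y 0 y' 0\<rbrakk> \<Longrightarrow> \<phi> y 0 = \<phi> y' 0"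
    using continuous_into_discrete_local[OF closed cont0[OF cont(1)]] by blast
  obtain M where M: "\<And>y y'. \<lbrakk>y \<in> X; y' \<in> X; same_window M y 0 y' 0\<rbrakk> \<Longrightarrow> \<psi> y 0 = \<psi> y' 0"
    using continuous_into_discrete_local[OF closed cont0[OF cont(2)]] by blast
  have "locally_derives N x w" unfolding locally_derives_def
  proof (intro allI impI)
    fix i j assume "same_window N x i x j"
    then have "\<phi> (translate i x) 0 = \<phi> (translate j x) 0"
      by (intro N tX) (simp add: same_window_translate)
    then have "translate (- i) z 0 = translate (- j) z 0" by (simp only: \<phi>t)
    then show "w i = w j" by (simp add: w_def reflect_def translate_def)
  qed
  moreover have "locally_derives M w x" unfolding locally_derives_def
  proof (intro allI impI)
    fix i j assume "same_window M w i w j"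
    then have "same_window M z (- i) z (- j)" by (simp add: w_def same_window_reflect)
    moreover have "translate t z \<in> X" for t
      using zX translate_in_orbit_closure unfolding X_def by blast
    ultimately have "\<psi> (translate (- i) z) 0 = \<psi> (translate (- j) z) 0"
      by (intro M) (simp_all add: same_window_translate)
    then have "translate i x 0 = translate j x 0"
      unfolding \<phi>t[symmetric] inv[OF tX] .
    then show "x i = x j" by (simp add: translate_def)
  qed
  ultimately have "locally_derives (max N M) x w \<and> locally_derives (max N M) w x"
    by (auto intro: locally_derives_mono)
  moreover have "reflect 0 w \<in> X" using zX by (simp add: w_def)
  ultimately show ?thesis by blast
qed


section \<open>Category\<close>

lemma nowhere_dense_subset:
  "nowhere_dense_in T A \<Longrightarrow> B \<subseteq> A \<Longrightarrow> nowhere_dense_in T B"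
  using interior_of_mono[OF closure_of_mono, of B A T T] unfolding nowhere_dense_in_def by auto

lemma meager_subset:
  assumes "meager_in T A" "B \<subseteq> A"
  shows "meager_in T B"
proof -
  obtain \<N> where N: "countable \<N>" "\<And>N. N \<in> \<N> \<Longrightarrow> nowhere_dense_in T N" "A = \<Union>\<N>"
    using assms(1) unfolding meager_in_def by blast
  have "B = \<Union>((\<lambda>N. N \<inter> B) ` \<N>)" using assms(2) N(3) by blast
  moreover have "countable ((\<lambda>N. N \<inter> B) ` \<N>)" using N(1) by simp
  moreover have "\<forall>N\<in>(\<lambda>N. N \<inter> B) ` \<N>. nowhere_dense_in T N"
    using N(2) nowhere_dense_subset by blast
  ultimately show ?thesis unfolding meager_in_def by blast
qed

lemma meager_Un:
  assumes "meager_in T A" "meager_in T B"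
  shows "meager_in T (A \<union> B)"
proof -
  obtain \<N> \<M> where "countable \<N>" "\<forall>N\<in>\<N>. nowhere_dense_in T N" "A = \<Union>\<N>"
    "countable \<M>" "\<forall>N\<in>\<M>. nowhere_dense_in T N" "B = \<Union>\<M>"
    using assms unfolding meager_in_def by blast
  then show ?thesis unfolding meager_in_def by (intro exI[of _ "\<N> \<union> \<M>"]) auto
qed

lemma compact_Hausdorff_not_meager:
  assumes "compact_space T" "Hausdorff_space T" "topspace T \<noteq> {}"
  shows "\<not> meager_in T (topspace T)"
proof
  assume "meager_in T (topspace T)"
  then obtain \<N> where N: "countable \<N>" "\<And>N. N \<in> \<N> \<Longrightarrow> nowhere_dense_in T N" "topspace T = \<Union>\<N>"
    unfolding meager_in_def by auto
  define G where "G = (\<lambda>N. T closure_of N) ` \<N>"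
  have "T interior_of \<Union>G = {}"
  proof (rule Baire_category_alt)
    show "completely_metrizable_space T \<or> locally_compact_space T \<and> regular_space T"
      by (intro disjI2 conjI compact_imp_locally_compact_space
          compact_Hausdorff_imp_regular_space assms(1,2))
    show "countable G" unfolding G_def using N(1) by (rule countable_image)
    show "closedin T C \<and> T interior_of C = {}" if "C \<in> G" for C
    proof -
      from that obtain N where "N \<in> \<N>" "C = T closure_of N" unfolding G_def by blast
      then show ?thesis using N(2)[of N] by (simp add: nowhere_dense_in_def)
    qed
  qed
  moreover have "topspace T \<subseteq> \<Union>G"
  proof
    fix a assume "a \<in> topspace T"
    then obtain N where NN: "N \<in> \<N>" "a \<in> N" unfolding N(3) by blast
    then have "N \<subseteq> T closure_of N"
      using N(2)[of N] unfolding nowhere_dense_in_def by (intro closure_of_subset) simp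
    then show "a \<in> \<Union>G" unfolding G_def using NN by blast
  qed
  then have "T interior_of topspace T \<subseteq> T interior_of \<Union>G" by (rule interior_of_mono)
  ultimately show False using assms(3) by simp
qed

lemma orbit_closure_not_meager:
  fixes x :: "int \<Rightarrow> 'a::finite"
  shows "\<not> meager_in (subtopology full_shift (orbit_closure x)) (orbit_closure x)"
proof -
  let ?T = "subtopology full_shift (orbit_closure x)"
  have "compactin full_shift (orbit_closure x)"
    by (rule closedin_compact_space[OF compact_full_shift closedin_orbit_closure])
  then have "compact_space ?T" by (rule compact_space_subtopology)
  moreover have "Hausdorff_space (full_shift :: (int \<Rightarrow> 'a) topology)"
    unfolding full_shift_def Hausdorff_space_product_topology
    using Hausdorff_space_discrete_topology by blast
  then have "Hausdorff_space ?T" by (rule Hausdorff_space_subtopology)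
  moreover have "topspace ?T \<noteq> {}"
    unfolding topspace_subtopology topspace_full_shift using orbit_closure_refl[of x] by blast
  ultimately have "\<not> meager_in ?T (topspace ?T)" by (rule compact_Hausdorff_not_meager)
  then show ?thesis by simp
qed

lemma toeplitz_translate: "toeplitz_sequence x \<Longrightarrow> toeplitz_sequence (translate t x)"
  unfolding toeplitz_sequence_def
proof
  fix i assume "\<forall>i. \<exists>p\<ge>1. \<forall>k. x i = x (i + k * int p)"
  then obtain p where "p \<ge> 1" "\<forall>k. x (i + t) = x (i + t + k * int p)" by blast
  then show "\<exists>p\<ge>1. \<forall>k. translate t x i = translate t x (i + k * int p)"
    by (intro exI[of _ p]) (simp add: translate_def algebra_simps)
qed

text \<open>
  The points for which position \<open>i\<close> is \<open>p\<close>-periodic form an open set, as the \<open>p\<close>-skeleton is locally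
  determined. The points for which \<open>i\<close> is not periodic at all thus form a closed set; it has
  empty interior because it misses the dense orbit of \<open>x\<close>.
\<close>

lemma non_toeplitz_meager:
  fixes x :: "int \<Rightarrow> 'a::finite"
  assumes x: "toeplitz_sequence x"
  defines "X \<equiv> orbit_closure x"
  shows "meager_in (subtopology full_shift X) {y \<in> X. \<not> toeplitz_sequence y}"
proof -
  let ?T = "subtopology full_shift X"
  have T[simp]: "topspace ?T = X" by simp
  define C where "C i = {y \<in> X. \<forall>p\<ge>1. i \<notin> Per p y}" for i
  have op: "openin ?T {y \<in> X. i \<in> Per p y}" if "p \<ge> 1" for i p
  proof (subst openin_subopen, intro ballI)
    fix y assume y: "y \<in> {y \<in> X. i \<in> Per p y}"
    have p0: "p > 0" using that by simp
    obtain N where N: "\<And>y z i j d. \<lbrakk>y \<in> X; z \<in> X; same_window N y i z j\<rbrakk> \<Longrightarrow>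
        skeleton p y (i + d) = skeleton p z (j + d)"
      using skeleton_local[OF x p0] unfolding X_def by blast
    define V where "V = {z. same_window (N + \<bar>i\<bar>) z 0 y 0} \<inter> X"
    have "z \<in> {y \<in> X. i \<in> Per p y}" if "z \<in> V" for z
    proof -
      have z: "z \<in> X" "same_window (N + \<bar>i\<bar>) z 0 y 0" using that by (auto simp: V_def)
      have "same_window N z i y i" unfolding same_window_def
      proof (intro allI impI)
        fix d :: int assume "\<bar>d\<bar> \<le> N"
        then have "\<bar>i + d\<bar> \<le> N + \<bar>i\<bar>" by linarith
        then show "z (i + d) = y (i + d)" using z(2) by (simp add: same_window_def)
      qed
      then have "skeleton p z i = skeleton p y i" using N[of z y i i 0] z(1) y by simp
      then show ?thesis using skeleton_eqD(1)[of p z i y i] y z(1) by simp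
    qed
    moreover have "openin ?T V" unfolding V_def openin_subtopology using openin_cylinder by blast
    moreover have "y \<in> V" using y by (simp add: V_def same_window_def)
    ultimately show "\<exists>U. openin ?T U \<and> y \<in> U \<and> U \<subseteq> {y \<in> X. i \<in> Per p y}" by blast
  qed
  have "nowhere_dense_in ?T (C i)" for i
  proof -
    have "X - C i = (\<Union>p\<in>{1..}. {y \<in> X. i \<in> Per p y})" by (auto simp: C_def)
    then have "openin ?T (X - C i)" using op by auto
    then have "closedin ?T (C i)" unfolding closedin_def T
      by (auto simp: C_def)
    moreover have "?T interior_of C i = {}"
    proof (rule ccontr)
      assume "?T interior_of C i \<noteq> {}"
      then obtain y V where V: "openin ?T V" "y \<in> V" "V \<subseteq> C i"
        unfolding interior_of_def by blast
      then obtain U where U: "openin full_shift U" "V = U \<inter> X"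
        unfolding openin_subtopology by blast
      then have "y \<in> U" "y \<in> X" using V(2) by blast+
      then have "y \<in> full_shift closure_of shift_orbit x"
        unfolding closure_of_shift_orbit X_def by blast
      then obtain t where t: "translate t x \<in> U"
        using U(1) \<open>y \<in> U\<close> unfolding in_closure_of shift_orbit_eq by blast
      have "translate t x \<in> X" unfolding X_def by (intro translate_in_orbit_closure orbit_closure_refl)
      then have "translate t x \<in> C i" using t U(2) V(3) by blast
      moreover have "\<exists>p\<ge>1. i \<in> Per p (translate t x)"
        using toeplitz_translate[OF x, of t] unfolding toeplitz_sequence_def Per_def by simp
      ultimately show False by (auto simp: C_def)
    qed
    ultimately show ?thesis
      unfolding nowhere_dense_in_def by (auto simp: closure_of_closedin C_def)
  qed
  moreover have "{y \<in> X. \<not> toeplitz_sequence y} = \<Union>(range C)"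
    by (auto simp: C_def toeplitz_sequence_def Per_def)
  ultimately show ?thesis unfolding meager_in_def by (intro exI[of _ "range C"]) simp
qed


section \<open>Nice symmetries as isomorphisms of block patterns\<close>

definition block_periodic :: "nat \<Rightarrow> nat \<Rightarrow> (int \<Rightarrow> 'a) \<Rightarrow> int \<Rightarrow> bool" where
  "block_periodic p q x k \<longleftrightarrow> (\<forall>r\<in>{0..<int p}. k * int p + r \<in> Per q x)"

definition same_block :: "nat \<Rightarrow> (int \<Rightarrow> 'a) \<Rightarrow> int \<Rightarrow> int \<Rightarrow> bool" where
  "same_block p x k k' \<longleftrightarrow> (\<forall>r\<in>{0..<int p}. x (k * int p + r) = x (k' * int p + r))"

text \<open>
  The two sequences have the same \<open>q\<close>-periodic blocks of length \<open>p\<close> and, among these, the same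
  coincidences. Nice symmetries are isomorphisms of this kind between a sequence and one of its
  reflections, see \<open>nice_symmetries_iff\<close>.
\<close>

definition block_isomorphic :: "nat \<Rightarrow> nat \<Rightarrow> (int \<Rightarrow> 'a) \<Rightarrow> (int \<Rightarrow> 'b) \<Rightarrow> bool" where
  "block_isomorphic p q x y \<longleftrightarrow>
    (\<forall>k. block_periodic p q x k \<longleftrightarrow> block_periodic p q y k) \<and>
    (\<forall>k k'. block_periodic p q x k \<and> block_periodic p q x k' \<longrightarrow>
       (same_block p x k k' \<longleftrightarrow> same_block p y k k'))"

lemma block_periodic_cong:
  assumes "int q dvd (k - k') * int p"
  shows "block_periodic p q x k \<longleftrightarrow> block_periodic p q x k'"
proof -
  have "k * int p + r \<in> Per q x \<longleftrightarrow> k' * int p + r \<in> Per q x" for r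
    using assms by (intro Per_cong_iff) (simp add: algebra_simps)
  then show ?thesis by (simp add: block_periodic_def)
qed

lemma block_periodic_same_block:
  assumes "block_periodic p q x k" "int q dvd (k - k') * int p"
  shows "same_block p x k k'"
proof -
  have "x (k' * int p + r) = x (k * int p + r)" if "r \<in> {0..<int p}" for r
    using assms that by (intro Per_eq[of _ q]) (auto simp: block_periodic_def algebra_simps)
  then show ?thesis by (simp add: same_block_def)
qed

lemma same_block_sym: "same_block p x k k' \<Longrightarrow> same_block p x k' k"
  by (simp add: same_block_def)

lemma same_block_trans: "same_block p x k k' \<Longrightarrow> same_block p x k' k'' \<Longrightarrow> same_block p x k k''"
  by (simp add: same_block_def)

text \<open>
  Moving the index of a \<open>q\<close>-periodic block by \<open>q/p\<close> does not change the block, so it suffices to compare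
  the blocks \<open>0 \<le> k < q/p\<close> that occur in the definition of nice symmetries.
\<close>

lemma block_isomorphic_one_period:
  fixes p q :: nat and x :: "int \<Rightarrow> 'a" and y :: "int \<Rightarrow> 'b"
  assumes "0 < p" "p dvd q" "0 < q"
  defines "I \<equiv> {0..<int (q div p)}"
  shows "block_isomorphic p q x y \<longleftrightarrow>
    (\<forall>k\<in>I. block_periodic p q x k \<longleftrightarrow> block_periodic p q y k) \<and>
    (\<forall>k\<in>I. \<forall>k'\<in>I. block_periodic p q x k \<and> block_periodic p q x k' \<longrightarrow>
       (same_block p x k k' \<longleftrightarrow> same_block p y k k'))" (is "?L \<longleftrightarrow> ?R")
proof
  assume ?L
  then show ?R unfolding block_isomorphic_def by blast
next
  assume R: ?R
  define \<kappa> where "\<kappa> k = k mod int (q div p)" for k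
  have qp: "int q = int (q div p) * int p"
    using assms(2) by (simp flip: of_nat_mult)
  have "q div p > 0" using assms(1-3) by (simp add: dvd_imp_le div_greater_zero_iff)
  then have \<kappa>: "\<kappa> k \<in> I" for k by (auto simp: \<kappa>_def I_def)
  have dvd: "int q dvd (k - \<kappa> k) * int p" for k
    unfolding qp \<kappa>_def by (intro mult_dvd_mono) simp_all
  have bx: "block_periodic p q x k \<longleftrightarrow> block_periodic p q x (\<kappa> k)"
    and per_y: "block_periodic p q y k \<longleftrightarrow> block_periodic p q y (\<kappa> k)" for k
    using block_periodic_cong[OF dvd] by blast+
  have per: "block_periodic p q x k \<longleftrightarrow> block_periodic p q y k" for k
    using R \<kappa>[of k] bx[of k] per_y[of k] by blast
  have same: "same_block p z k k' \<longleftrightarrow> same_block p z (\<kappa> k) (\<kappa> k')"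
    if "block_periodic p q z k" "block_periodic p q z k'" for z :: "int \<Rightarrow> 'c" and k k'
    using block_periodic_same_block[OF that(1) dvd] block_periodic_same_block[OF that(2) dvd]
    by (blast intro: same_block_sym same_block_trans)
  have "same_block p x k k' \<longleftrightarrow> same_block p y k k'"
    if "block_periodic p q x k" "block_periodic p q x k'" for k k'
  proof -
    have "same_block p x (\<kappa> k) (\<kappa> k') \<longleftrightarrow> same_block p y (\<kappa> k) (\<kappa> k')"
      using R \<kappa>[of k] \<kappa>[of k'] that bx by blast
    then show ?thesis
      using same[of x k k'] same[of y k k'] that per[of k] per[of k'] by blast
  qed
  then show ?L using per unfolding block_isomorphic_def by blast
qed

lemma block_isomorphic_skeleton_cong:
  assumes "\<And>i. skeleton q y i = skeleton q y' i"
  shows "block_isomorphic p q x y \<longleftrightarrow> block_isomorphic p q x y'"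
proof -
  have P: "block_periodic p q y k \<longleftrightarrow> block_periodic p q y' k" for k
    using skeleton_eqD(1)[OF assms] by (simp add: block_periodic_def)
  have "same_block p y k k' \<longleftrightarrow> same_block p y' k k'"
    if "block_periodic p q y k" "block_periodic p q y k'" for k k'
    using that skeleton_eqD(2)[OF assms] by (simp add: same_block_def block_periodic_def)
  then show ?thesis unfolding block_isomorphic_def using P by blast
qed

lemma subword_eq_iff:
  "subword x a (a + int p) = subword x b (b + int p) \<longleftrightarrow> (\<forall>r\<in>{0..<int p}. x (a + r) = x (b + r))"
proof -
  have "subword x a (a + int p) = subword x b (b + int p) \<longleftrightarrow>
      (\<forall>i<p. x (a + int i) = x (b + int i))"
    by (simp add: subword_def list_eq_iff_nth_eq)
  also have "\<dots> \<longleftrightarrow> (\<forall>r\<in>{0..<int p}. x (a + r) = x (b + r))"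
  proof
    assume H: "\<forall>i<p. x (a + int i) = x (b + int i)"
    show "\<forall>r\<in>{0..<int p}. x (a + r) = x (b + r)"
    proof
      fix r assume "r \<in> {0..<int p}"
      then show "x (a + r) = x (b + r)" using H[rule_format, of "nat r"] by (simp add: nat_less_iff)
    qed
  qed simp
  finally show ?thesis .
qed

lemma block_periodic_interval:
  "{k * int p..<(k + 1) * int p} \<subseteq> Per q x \<longleftrightarrow> block_periodic p q x k"
proof -
  have "{k * int p..<(k + 1) * int p} = (\<lambda>r. k * int p + r) ` {0..<int p}"
    by (simp add: algebra_simps)
  then show ?thesis unfolding block_periodic_def by (simp only: image_subset_iff)
qed

lemma block_periodic_reflect_interval:
  "{m - (k + 1) * int p..<m - k * int p} \<subseteq> Per q x \<longleftrightarrow> block_periodic p q (reflect (m - 1) x) k"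
proof -
  have "{m - (k + 1) * int p..<m - k * int p} = (\<lambda>r. m - 1 - (k * int p + r)) ` {0..<int p}"
    (is "?A = ?f ` ?B")
  proof (intro equalityI subsetI)
    fix i assume "i \<in> ?A"
    then have "m - 1 - k * int p - i \<in> ?B" by (auto simp: algebra_simps)
    then show "i \<in> ?f ` ?B" by (rule rev_image_eqI) simp
  qed (auto simp: algebra_simps)
  then show ?thesis by (auto simp: block_periodic_def Per_reflect)
qed

lemma subword_block:
  "subword x (k * int p) ((k + 1) * int p) = subword x (k' * int p) ((k' + 1) * int p)
    \<longleftrightarrow> same_block p x k k'"
  using subword_eq_iff[of x "k * int p" p "k' * int p"]
  by (simp add: same_block_def algebra_simps)

lemma subword_reflect_block:
  "subword x (m - (k + 1) * int p) (m - k * int p) = subword x (m - (k' + 1) * int p) (m - k' * int p)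
    \<longleftrightarrow> same_block p (reflect (m - 1) x) k k'"
proof -
  have "subword x (m - (k + 1) * int p) (m - k * int p) = subword x (m - (k' + 1) * int p) (m - k' * int p)
    \<longleftrightarrow> (\<forall>r\<in>{0..<int p}. x (m - (k + 1) * int p + r) = x (m - (k' + 1) * int p + r))"
    using subword_eq_iff[of x "m - (k + 1) * int p" p "m - (k' + 1) * int p"]
    by (simp add: algebra_simps)
  also have "\<dots> \<longleftrightarrow> (\<forall>r\<in>{0..<int p}. x (m - 1 - (k * int p + r)) = x (m - 1 - (k' * int p + r)))"
    (is "?L \<longleftrightarrow> ?R")
  proof
    assume L: ?L
    show ?R
    proof
      fix r assume "r \<in> {0..<int p}"
      then have "int p - 1 - r \<in> {0..<int p}" by auto
      from L[rule_format, OF this] show "x (m - 1 - (k * int p + r)) = x (m - 1 - (k' * int p + r))"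
        by (simp add: algebra_simps)
    qed
  next
    assume R: ?R
    show ?L
    proof
      fix r assume "r \<in> {0..<int p}"
      then have "int p - 1 - r \<in> {0..<int p}" by auto
      from R[rule_format, OF this] show "x (m - (k + 1) * int p + r) = x (m - (k' + 1) * int p + r)"
        by (simp add: algebra_simps)
    qed
  qed
  finally show ?thesis by (simp add: same_block_def reflect_def)
qed

text \<open>
  The block \<open>[m - (k+1)p, m - kp)\<close> is the image of \<open>[kp, (k+1)p)\<close> under \<open>i \<mapsto> m - 1 - i\<close>, whence \<open>n = m - 1\<close>.
  Whether a reflection is a symmetry depends on \<open>n\<close> modulo \<open>q\<close> only, so that the
  bounds on \<open>m\<close> amount to a choice of representative.
\<close>

lemma nice_symmetries_iff:
  assumes "0 < p" "p dvd q" "0 < q"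
  shows "nice_symmetries x p q \<longleftrightarrow> (\<exists>n. block_isomorphic p q x (reflect n x))"
proof -
  have eq: "nice_symmetries x p q \<longleftrightarrow>
      (\<exists>m. 1 < m \<and> m \<le> int q + 1 \<and> block_isomorphic p q x (reflect (m - 1) x))"
    unfolding nice_symmetries_def block_isomorphic_one_period[OF assms]
      block_periodic_interval block_periodic_reflect_interval subword_block subword_reflect_block
    by (intro arg_cong[where f = Ex] ext) (simp add: Ball_def imp_conjL; blast)
  have "\<exists>m. 1 < m \<and> m \<le> int q + 1 \<and> block_isomorphic p q x (reflect (m - 1) x)"
    if n: "block_isomorphic p q x (reflect n x)" for n
  proof -
    define m where "m = (n - 1) mod int q + 2"
    have m: "1 < m" "m \<le> int q + 1"
      using pos_mod_bound[of "int q" "n - 1"] pos_mod_sign[of "int q" "n - 1"] assms(3)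
      unfolding m_def by linarith+
    have "int q dvd (n - 1) - (n - 1) mod int q" by simp
    moreover have "n - (m - 1) = (n - 1) - (n - 1) mod int q" by (simp add: m_def)
    ultimately have "int q dvd n - (m - 1)" by (simp only:)
    moreover have "n - i - (m - 1 - i) = n - (m - 1)" for i by simp
    ultimately have "int q dvd n - i - (m - 1 - i)" for i by (simp only:)
    then have "skeleton q (reflect n x) i = skeleton q (reflect (m - 1) x) i" for i
      unfolding skeleton_reflect by (rule skeleton_cong)
    then have "block_isomorphic p q x (reflect (m - 1) x)"
      using n block_isomorphic_skeleton_cong by blast
    then show ?thesis using m by blast
  qed
  then show ?thesis unfolding eq by blast
qed


section \<open>From local rules to symmetries\<close>

lemma Per_locally_derives:
  assumes "locally_derives N x w" "\<And>d. \<bar>d\<bar> \<le> N \<Longrightarrow> i + d \<in> Per q x"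
  shows "i \<in> Per q w"
proof -
  have "w i = w (i + k * int q)" for k
  proof -
    have "x (i + d) = x (i + k * int q + d)" if "\<bar>d\<bar> \<le> N" for d
      using PerD[OF assms(2)[OF that], of k] by (simp add: algebra_simps)
    then show ?thesis using assms(1) unfolding locally_derives_def same_window_def by blast
  qed
  then show ?thesis by (simp add: Per_def)
qed

text \<open>
  Positions near a block boundary are congruent modulo \<open>p\<close> to positions near \<open>0\<close>.
\<close>

lemma block_margin_Per:
  assumes "{-N..N} \<subseteq> Per p x" "- N \<le> s" "s < int p + N" "s \<notin> {0..<int p}"
  shows "k * int p + s \<in> Per p x"
proof (cases "s < 0")
  case True
  then have "s \<in> Per p x" using assms(1,2) by auto
  then show ?thesis by (rule Per_cong_mem) simp
next
  case False
  then have "s - int p \<in> Per p x" using assms by auto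
  then show ?thesis by (rule Per_cong_mem) (simp add: algebra_simps)
qed

text \<open>
  The letters of \<open>w\<close> in a block depend on the same block of \<open>x\<close> and on the margins of width \<open>N\<close> around
  it, and the margins are \<open>p\<close>-periodic.
\<close>

lemma locally_derives_blocks:
  assumes "locally_derives N x w" "{-N..N} \<subseteq> Per p x" "p dvd q"
  shows "block_periodic p q x k \<Longrightarrow> block_periodic p q w k"
    and "same_block p x k k' \<Longrightarrow> same_block p w k k'"
proof -
  assume b: "block_periodic p q x k"
  have ext: "k * int p + s \<in> Per q x" if "- N \<le> s" "s < int p + N" for s
  proof (cases "s \<in> {0..<int p}")
    case True
    then show ?thesis using b by (simp add: block_periodic_def)
  next
    case False
    from block_margin_Per[OF assms(2) that False] show ?thesis
      using Per_mono[OF assms(3)] by blast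
  qed
  have "k * int p + r + d \<in> Per q x" if "r \<in> {0..<int p}" "\<bar>d\<bar> \<le> N" for r d
  proof -
    have "- N \<le> r + d" "r + d < int p + N" using that by auto
    from ext[OF this] show ?thesis by (simp add: add.assoc)
  qed
  then show "block_periodic p q w k"
    unfolding block_periodic_def by (intro ballI Per_locally_derives[OF assms(1)])
next
  assume b: "same_block p x k k'"
  have ext: "x (k * int p + s) = x (k' * int p + s)" if "- N \<le> s" "s < int p + N" for s
  proof (cases "s \<in> {0..<int p}")
    case True
    then show ?thesis using b by (simp add: same_block_def)
  next
    case False
    have "k * int p + s - (k' * int p + s) = (k - k') * int p" by (simp add: algebra_simps)
    then have "int p dvd k * int p + s - (k' * int p + s)" by simp
    from Per_eq[OF block_margin_Per[OF assms(2) that False] this] show ?thesis by simp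
  qed
  have "w (k * int p + r) = w (k' * int p + r)" if r: "r \<in> {0..<int p}" for r
  proof -
    have "same_window N x (k * int p + r) x (k' * int p + r)" unfolding same_window_def
    proof (intro allI impI)
      fix d :: int assume "\<bar>d\<bar> \<le> N"
      then have "- N \<le> r + d" "r + d < int p + N" using r by auto
      from ext[OF this] show "x (k * int p + r + d) = x (k' * int p + r + d)"
        by (simp add: add.assoc)
    qed
    then show ?thesis using assms(1) by (simp add: locally_derives_def)
  qed
  then show "same_block p w k k'" by (simp add: same_block_def)
qed

text \<open>
  Twice the radius is needed: the \<open>p\<close>-periodic margins of \<open>w\<close>, which serve for the rule leading from
  \<open>w\<close> back to \<open>x\<close>, are themselves derived from windows of \<open>x\<close>.
\<close>

lemma block_isomorphic_of_locally_derives: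
  assumes "locally_derives N x w" "locally_derives N w x" "{-2*N..2*N} \<subseteq> Per p x" "p dvd q" "N \<ge> 0"
  shows "block_isomorphic p q x w"
proof -
  have x: "{-N..N} \<subseteq> Per p x" using assms(3,5) by auto
  have w: "{-N..N} \<subseteq> Per p w"
  proof
    fix i assume i: "i \<in> {-N..N}"
    show "i \<in> Per p w"
    proof (rule Per_locally_derives[OF assms(1)])
      fix d :: int assume "\<bar>d\<bar> \<le> N"
      then have "i + d \<in> {-2*N..2*N}" using i by auto
      then show "i + d \<in> Per p x" using assms(3) by blast
    qed
  qed
  show ?thesis unfolding block_isomorphic_def
    using locally_derives_blocks[OF assms(1) x assms(4)] locally_derives_blocks[OF assms(2) w assms(4)]
    by blast
qed


section \<open>From symmetries to local rules\<close>

text \<open>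
  A window of radius at least \<open>p\<close> contains the entire block around its centre. Two equal windows have
  their centres at the same offset within these blocks, so the blocks of \<open>x\<close> coincide, and
  with them those of \<open>w\<close>.
\<close>

lemma locally_derives_of_same_block:
  assumes "\<And>i j. same_window N x i x j \<Longrightarrow> int p dvd i - j" "int p \<le> N" "p > 0"
    and "\<And>k k'. same_block p x k k' \<Longrightarrow> same_block p w k k'"
  shows "locally_derives N x w"
  unfolding locally_derives_def
proof (intro allI impI)
  fix i j assume w: "same_window N x i x j"
  define r where "r = i mod int p"
  have r: "r \<in> {0..<int p}" using assms(3) by (simp add: r_def)
  have "j mod int p = r" using assms(1)[OF w] by (simp add: r_def mod_eq_dvd_iff dvd_diff_commute[of _ j])
  then have ij: "i = (i div int p) * int p + r" "j = (j div int p) * int p + r"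
    using div_mult_mod_eq[of i "int p"] div_mult_mod_eq[of j "int p"] by (simp_all add: r_def)
  have "same_block p x (i div int p) (j div int p)" unfolding same_block_def
  proof
    fix s assume s: "s \<in> {0..<int p}"
    have "\<bar>s - r\<bar> \<le> N" using s r assms(2) by auto
    then have "x (i + (s - r)) = x (j + (s - r))" using w by (simp add: same_window_def)
    moreover have "i + (s - r) = (i div int p) * int p + s" "j + (s - r) = (j div int p) * int p + s"
      using ij by linarith+
    ultimately show "x (i div int p * int p + s) = x (j div int p * int p + s)" by simp
  qed
  then have "w (i div int p * int p + r) = w (j div int p * int p + r)"
    using assms(4) r by (simp add: same_block_def)
  then show "w i = w j" using ij by simp
qed

text \<open>
  The sequence \<open>w\<close> is a cluster point of the reflections \<open>i \<mapsto> x(n - i)\<close> belonging to growing sets \<open>F\<close>.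
  Any two blocks are \<open>q\<close>-periodic for all late terms of the sequence, so that the symmetries control their
  coincidence.
\<close>

lemma ex_block_reflection:
  fixes x :: "int \<Rightarrow> 'a::finite"
  assumes "\<And>F. finite F \<Longrightarrow> \<exists>q n. F \<subseteq> Per q x \<and> block_isomorphic p q x (reflect n x)"
  shows "\<exists>w. reflect 0 w \<in> orbit_closure x \<and> (\<forall>k k'. same_block p x k k' \<longleftrightarrow> same_block p w k k')"
proof -
  \<comment> \<open>All blocks with index of modulus at most \<open>K\<close> lie in \<open>[-B K, B K]\<close>.\<close>
  define B where "B K = (int K + 1) * int p" for K
  have "\<forall>K. \<exists>q n. {-B K..B K} \<subseteq> Per q x \<and> block_isomorphic p q x (reflect n x)"
    using assms by blast
  then obtain q n where qn: "\<And>K. {-B K..B K} \<subseteq> Per (q K) x"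
    "\<And>K. block_isomorphic p (q K) x (reflect (n K) x)" by metis
  obtain w where w: "\<And>r. infinite {K. same_window r (reflect (n K) x) 0 w 0}"
    using cluster_point[of "\<lambda>K. reflect (n K) x"] by blast
  have B: "- B K \<le> k * int p + r \<and> k * int p + r \<le> B K" if "\<bar>k\<bar> \<le> int K" "r \<in> {0..<int p}" for k r K
  proof -
    have "k * int p \<le> int K * int p" using that by (intro mult_right_mono) auto
    moreover have "(- int K) * int p \<le> k * int p" using that by (intro mult_right_mono) auto
    moreover have "B K = int K * int p + int p" by (simp add: B_def algebra_simps)
    ultimately show ?thesis using that(2) unfolding atLeastLessThan_iff by linarith
  qed
  have "same_block p x k k' \<longleftrightarrow> same_block p w k k'" for k k'
  proof -
    define m where "m = nat (max \<bar>k\<bar> \<bar>k'\<bar>)"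
    have m: "\<bar>k\<bar> \<le> int m" "\<bar>k'\<bar> \<le> int m" unfolding m_def by linarith+
    obtain K where K: "K \<ge> m" "same_window (B m) (reflect (n K) x) 0 w 0"
      using cluster_point_late[OF w] by blast
    have "block_periodic p (q K) x l" if "\<bar>l\<bar> \<le> int m" for l
      unfolding block_periodic_def
    proof
      fix r assume "r \<in> {0..<int p}"
      then have "l * int p + r \<in> {-B K..B K}" using B[of l K r] that K(1) by auto
      then show "l * int p + r \<in> Per (q K) x" using qn(1) by blast
    qed
    then have "same_block p x k k' \<longleftrightarrow> same_block p (reflect (n K) x) k k'"
      using qn(2)[of K] m unfolding block_isomorphic_def by blast
    also have "\<dots> \<longleftrightarrow> same_block p w k k'"
    proof -
      have "reflect (n K) x (l * int p + r) = w (l * int p + r)"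
        if "\<bar>l\<bar> \<le> int m" "r \<in> {0..<int p}" for l r
      proof -
        have "\<bar>l * int p + r\<bar> \<le> B m" using B[OF that] by (simp add: abs_le_iff)
        then show ?thesis using K(2) by (simp add: same_window_def)
      qed
      then show ?thesis using m by (simp add: same_block_def)
    qed
    finally show ?thesis .
  qed
  moreover have "reflect 0 w \<in> orbit_closure x" unfolding orbit_closure_def mem_Collect_eq
  proof
    fix r
    obtain K where "same_window r (reflect (n K) x) 0 w 0"
      using cluster_point_late[OF w] by blast
    then have "same_window r (reflect 0 w) 0 x (n K)"
      using same_window_reflect[of r "n K" x 0 0 "reflect 0 w" 0] same_window_commute[of r x]
      by simp
    then show "\<exists>t. same_window r (reflect 0 w) 0 x t" by blast
  qed
  ultimately show ?thesis by blast
qed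

text \<open>
  This covers the case of a finite subshift, where \<open>p\<close> may be the entire scale and there is no
  larger \<open>q\<close>: either all blocks are \<open>p\<close>-periodic, and then they are all equal, or none is.
\<close>

lemma block_isomorphic_trivial:
  assumes "p > 0"
  shows "block_isomorphic p p x (reflect n x)"
proof -
  have P: "block_periodic p p y k \<longleftrightarrow> (\<forall>i. i \<in> Per p y)" for y :: "int \<Rightarrow> 'a" and k
  proof
    assume b: "block_periodic p p y k"
    show "\<forall>i. i \<in> Per p y"
    proof
      fix i
      have "i mod int p \<in> {0..<int p}" using assms by simp
      then have "k * int p + i mod int p \<in> Per p y" using b by (simp add: block_periodic_def)
      moreover have "k * int p + i mod int p - i = (k - i div int p) * int p"
        by (simp add: algebra_simps minus_mult_div_eq_mod[symmetric])
      ultimately show "i \<in> Per p y" by (auto intro: Per_cong_mem)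
    qed
  qed (simp add: block_periodic_def)
  have "(\<forall>i. i \<in> Per p (reflect n x)) \<longleftrightarrow> (\<forall>i. i \<in> Per p x)"
    (is "?L \<longleftrightarrow> ?R")
  proof
    assume ?L
    then have "n - (n - i) \<in> Per p x" for i unfolding Per_reflect by blast
    then show ?R by simp
  qed (simp add: Per_reflect)
  moreover have "same_block p y k k'" if "\<forall>i. i \<in> Per p y" for y :: "int \<Rightarrow> 'a" and k k'
    using that unfolding P[of y k, symmetric] by (rule block_periodic_same_block) simp
  ultimately show ?thesis unfolding block_isomorphic_def P by blast
qed


section \<open>Shifts conjugate to their inverses\<close>

lemma conjugate_imp_nice_symmetries:
  fixes x :: "int \<Rightarrow> 'a::finite"
  defines "X \<equiv> orbit_closure x"
  assumes x: "toeplitz_sequence x"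
    and "conjugate (subtopology full_shift X) shift (subtopology full_shift X) (inv shift)"
  shows "\<exists>p. nice_symmetries_along (sequence_scale x) x p"
proof -
  obtain w N0 where w: "reflect 0 w \<in> orbit_closure x"
    and N0: "locally_derives N0 x w" "locally_derives N0 w x"
    using locally_derives_of_conjugate assms(3) unfolding X_def by blast
  define N where "N = \<bar>N0\<bar>"
  have N: "locally_derives N x w" "locally_derives N w x" "N \<ge> 0"
    using N0[THEN locally_derives_mono, of N] by (auto simp: N_def)
  obtain p where p: "p > 0" "supernatural_dvd (supernatural_of_nat p) (sequence_scale x)"
    "{-2*N..2*N} \<subseteq> Per p x"
    using finite_subset_Per_scale[OF x, of "{-2*N..2*N}"] by blast
  have "nice_symmetries x p q" if q: "p dvd q" "p < q" for q
  proof -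
    have q0: "q > 0" using q(2) by simp
    obtain m where m: "\<And>i. skeleton q (reflect 0 w) i = skeleton q x (i + m)"
      using skeleton_aligned[OF x q0 w] by blast
    have "skeleton q w i = skeleton q (reflect m x) i" for i
      using m[of "- i"] by (simp add: skeleton_reflect)
    then have "block_isomorphic p q x (reflect m x)"
      using block_isomorphic_of_locally_derives[OF N(1,2) p(3) q(1) N(3)]
        block_isomorphic_skeleton_cong by blast
    then show ?thesis using nice_symmetries_iff[OF p(1) q(1) q0] by blast
  qed
  then show ?thesis using p(1,2) unfolding nice_symmetries_along_def by blast
qed

lemma nice_symmetries_imp_conjugate:
  fixes x :: "int \<Rightarrow> 'a::finite"
  defines "X \<equiv> orbit_closure x"
  assumes x: "toeplitz_sequence x" and nice: "nice_symmetries_along (sequence_scale x) x p"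
  shows "conjugate (subtopology full_shift X) shift (subtopology full_shift X) (inv shift)"
proof -
  have p: "p > 0" "supernatural_dvd (supernatural_of_nat p) (sequence_scale x)"
    and ns: "\<And>q. \<lbrakk>supernatural_dvd (supernatural_of_nat q) (sequence_scale x); p dvd q; p < q\<rbrakk>
      \<Longrightarrow> nice_symmetries x p q"
    using nice by (auto simp: nice_symmetries_along_def)
  have "\<exists>q n. F \<subseteq> Per q x \<and> block_isomorphic p q x (reflect n x)" if fin: "finite F" for F
  proof -
    obtain q0 where q0: "q0 > 0" "supernatural_dvd (supernatural_of_nat q0) (sequence_scale x)"
      "F \<subseteq> Per q0 x" using finite_subset_Per_scale[OF x fin] by blast
    \<comment> \<open>This may be \<open>p\<close> itself, for which the hypothesis says nothing.\<close>
    define q where "q = lcm p q0"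
    have q: "q > 0" "p dvd q" "F \<subseteq> Per q x"
      using p(1) q0 Per_mono[of q0 q x] by (auto simp: q_def lcm_pos_nat)
    have "supernatural_dvd (supernatural_of_nat q) (sequence_scale x)"
      unfolding q_def by (rule supernatural_dvd_lcm[OF p(1) q0(1) p(2) q0(2)])
    then have "nice_symmetries x p q" if "q \<noteq> p"
      using ns[of q] q(2) that dvd_imp_le[OF q(2,1)] by simp
    then have "\<exists>n. block_isomorphic p q x (reflect n x)"
      using nice_symmetries_iff[OF p(1) q(2,1)] block_isomorphic_trivial[OF p(1)] by blast
    then show ?thesis using q(3) by blast
  qed
  from ex_block_reflection[OF this] obtain w where w: "reflect 0 w \<in> orbit_closure x"
    and blocks: "\<And>k k'. same_block p x k k' \<longleftrightarrow> same_block p w k k'" by blast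
  obtain N0 where N0: "\<And>y i j. \<lbrakk>y \<in> orbit_closure x; same_window N0 y i y j\<rbrakk> \<Longrightarrow> int p dvd i - j"
    using scale_divisor_recognizable[OF x p] by blast
  define N where "N = max N0 (int p)"
  have N: "int p dvd i - j" if "y \<in> orbit_closure x" "same_window N y i y j" for y i j
    using N0[OF that(1)] same_window_mono[OF that(2), of N0] by (simp add: N_def)
  have "locally_derives N x w"
    by (rule locally_derives_of_same_block[OF _ _ p(1)])
       (use N[OF orbit_closure_refl] blocks in \<open>auto simp: N_def\<close>)
  moreover have "locally_derives N w x"
  proof (rule locally_derives_of_same_block[OF _ _ p(1)])
    fix i j assume "same_window N w i w j"
    then have "same_window N (reflect 0 w) (- i) (reflect 0 w) (- j)"
      by (simp add: same_window_reflect)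
    from N[OF w this] show "int p dvd i - j" by (simp add: dvd_diff_commute)
  qed (use blocks in \<open>auto simp: N_def\<close>)
  ultimately show ?thesis unfolding X_def by (rule conjugate_of_locally_derives[OF x w])
qed

theorem theorem6p2:
  fixes X :: "(int \<Rightarrow> 'a::finite) set" and u :: supernatural
  assumes "toeplitz_subshift X"
    and "scale X = u"
  shows "(conjugate (subtopology full_shift X) shift (subtopology full_shift X) (inv shift)
          \<longleftrightarrow>
          (\<forall>x\<in>X. toeplitz_sequence x \<longrightarrow> (\<exists>p. nice_symmetries_along u x p)))
       \<and> ((\<forall>x\<in>X. toeplitz_sequence x \<longrightarrow> (\<exists>p. nice_symmetries_along u x p))
          \<longleftrightarrow>
          \<not> meager_in (subtopology full_shift X) {x\<in>X. \<exists>p. nice_symmetries_along u x p})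
       \<and> (\<not> meager_in (subtopology full_shift X) {x\<in>X. \<exists>p. nice_symmetries_along u x p}
          \<longleftrightarrow>
          (\<exists>x\<in>X. \<exists>p. toeplitz_sequence x \<and> nice_symmetries_along u x p))"
proof -
  let ?T = "subtopology full_shift X"
  let ?A = "{x\<in>X. \<exists>p. nice_symmetries_along u x p}"
  obtain x0 where x0: "toeplitz_sequence x0" "X = orbit_closure x0"
    using assms(1) unfolding toeplitz_subshift_def closure_of_shift_orbit by blast
  have X: "X = orbit_closure x" if "x \<in> X" for x
    using toeplitz_orbit_closure_minimal[OF x0(1)] that x0(2) by simp
  have u: "sequence_scale x = u" if "x \<in> X" for x
  proof -
    define y where "y = (SOME x. x \<in> X \<and> toeplitz_sequence x)"
    have "x0 \<in> X \<and> toeplitz_sequence x0" using x0 orbit_closure_refl by blast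
    then have "y \<in> X \<and> toeplitz_sequence y"
      unfolding y_def by (rule someI[where P = "\<lambda>x. x \<in> X \<and> toeplitz_sequence x"])
    then have "sequence_scale y = sequence_scale x0"
      using sequence_scale_orbit_closure[OF x0(1)] x0(2) by blast
    moreover have "sequence_scale x = sequence_scale x0"
      using sequence_scale_orbit_closure[OF x0(1)] that x0(2) by blast
    ultimately show ?thesis using assms(2) by (simp add: scale_def y_def)
  qed
  have mt: "meager_in ?T {x \<in> X. \<not> toeplitz_sequence x}"
    using non_toeplitz_meager[OF x0(1)] x0(2) by simp
  have 12: "\<forall>x\<in>X. toeplitz_sequence x \<longrightarrow> (\<exists>p. nice_symmetries_along u x p)"
    if "conjugate ?T shift ?T (inv shift)"
  proof (intro ballI impI)
    fix x assume x: "x \<in> X" "toeplitz_sequence x"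
    show "\<exists>p. nice_symmetries_along u x p"
      using conjugate_imp_nice_symmetries[OF x(2)] that
      unfolding X[OF x(1), symmetric] u[OF x(1)] .
  qed
  have 23: "\<not> meager_in ?T ?A"
    if "\<forall>x\<in>X. toeplitz_sequence x \<longrightarrow> (\<exists>p. nice_symmetries_along u x p)"
  proof
    assume "meager_in ?T ?A"
    then have "meager_in ?T (?A \<union> {x \<in> X. \<not> toeplitz_sequence x})" using mt by (rule meager_Un)
    moreover have "X \<subseteq> ?A \<union> {x \<in> X. \<not> toeplitz_sequence x}" using that by blast
    ultimately have "meager_in ?T X" by (rule meager_subset)
    then show False using orbit_closure_not_meager[of x0] x0(2) by simp
  qed
  have 34: "\<exists>x\<in>X. \<exists>p. toeplitz_sequence x \<and> nice_symmetries_along u x p" if "\<not> meager_in ?T ?A"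
  proof (rule ccontr)
    assume "\<not> ?thesis"
    then have "?A \<subseteq> {x \<in> X. \<not> toeplitz_sequence x}" by blast
    then show False using meager_subset[OF mt] that by blast
  qed
  have 41: "conjugate ?T shift ?T (inv shift)"
    if ex: "\<exists>x\<in>X. \<exists>p. toeplitz_sequence x \<and> nice_symmetries_along u x p"
  proof -
    obtain x p where x: "x \<in> X" "toeplitz_sequence x" and p: "nice_symmetries_along u x p"
      using ex by blast
    show ?thesis
      using nice_symmetries_imp_conjugate[OF x(2), of p] p
      unfolding X[OF x(1), symmetric] u[OF x(1)] .
  qed
  show ?thesis using 12 23 34 41 by blast
qed

end
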